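(* Let $l\ge 1$ and let $\Gamma_1,\ldots,\Gamma_l$ be finite, non-empty, connected graphs with $k_1,\ldots,k_l$ vertices respectively, and let $\Gamma_J$ be their join. Let $k=\sum_{i=1}^l k_i$ be the number of vertices of $\Gamma_J$. Then \[ |\operatorname{Pic}^0(\Gamma_J)| = k^{l-2}\prod_{i=1}^{l}|P_{\Gamma_i}(k_i-k)|, \] where $P_{\Gamma_i}(x)$ is the characteristic polynomial of the rational Laplacian operator of $\Gamma_i$.
   Context: The join of graphs $\Gamma_1,\dots,\Gamma_l$ is obtained from their disjoint union by adding an edge between every vertex of $\Gamma_i$ and every vertex of $\Gamma_j$ for all $i\neq j$. For a graph $\Gamma$, $\operatorname{Div}(\Gamma)$ is the free abelian group on $V(\Gamma)$, $\operatorname{Div}^0(\Gamma)$ is the kernel of the degree map $\sum a_v v\mapsto \sum a_v$, the Laplacian $\Delta(\Gamma):\operatorname{Div}(\Gamma)\to\operatorname{Div}^0(\Gamma)$ is given by $v\mapsto (\deg v)\,v-\sum_{wv\in E(\Gamma)} w$, and $\operatorname{Pic}^0(\Gamma)=\operatorname{Div}^0(\Gamma)/\operatorname{im}\Delta(\Gamma)$. The rational Laplacian operator is the endomorphism of $\operatorname{Div}^0(\Gamma)\otimes_{\mathbb{Z}}\mathbb{Q}$ induced by $\Delta(\Gamma)$, and $P_\Gamma(x)$ is its characteristic polynomial, with the convention $P_\Gamma(x)=1$ if $\Gamma$ has one vertex. *)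

theory Defs
  imports
    "Graph_Theory.Graph_Theory"
    "Jordan_Normal_Form.Char_Poly"
    "HOL-Algebra.Free_Abelian_Groups"
begin

text \<open>
  A finite simple graph is a \<open>pair_graph\<close>: a finite, loop-free digraph whose arc set is a
  symmetric relation, the edge \<open>wv\<close> being represented by the two arcs \<open>(w,v)\<close> and \<open>(v,w)\<close>.
\<close>

definition graph_join :: "nat \<Rightarrow> (nat \<Rightarrow> 'a pair_pre_digraph) \<Rightarrow> (nat \<times> 'a) pair_pre_digraph" where
  "graph_join l \<Gamma> =
    \<lparr> pverts = (SIGMA i:{1..l}. pverts (\<Gamma> i)),
      parcs = {((i, u), (i, v)) | i u v. i \<in> {1..l} \<and> (u, v) \<in> parcs (\<Gamma> i)}
            \<union> {((i, u), (j, v)) | i j u v. i \<in> {1..l} \<and> j \<in> {1..l} \<and> i \<noteq> j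
                 \<and> u \<in> pverts (\<Gamma> i) \<and> v \<in> pverts (\<Gamma> j)} \<rparr>"

definition Div :: "'a pair_pre_digraph \<Rightarrow> ('a \<Rightarrow>\<^sub>0 int) monoid" where
  "Div G = free_Abelian_group (pverts G)"

definition div_degree :: "('a \<Rightarrow>\<^sub>0 int) \<Rightarrow> int" where
  "div_degree D = (\<Sum>v\<in>Poly_Mapping.keys D. Poly_Mapping.lookup D v)"

definition Div0 :: "'a pair_pre_digraph \<Rightarrow> ('a \<Rightarrow>\<^sub>0 int) monoid" where
  "Div0 G = (Div G)\<lparr>carrier := kernel (Div G) integer_group div_degree\<rparr>"

definition laplacian :: "'a pair_pre_digraph \<Rightarrow> ('a \<Rightarrow>\<^sub>0 int) \<Rightarrow> ('a \<Rightarrow>\<^sub>0 int)" where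
  "laplacian G = frag_extend (\<lambda>v.
     frag_cmul (int (out_degree (with_proj G) v)) (frag_of v)
       - (\<Sum>w | (w, v) \<in> parcs G. frag_of w))"

definition Pic0 :: "'a pair_pre_digraph \<Rightarrow> ('a \<Rightarrow>\<^sub>0 int) set monoid" where
  "Pic0 G = Div0 G Mod (laplacian G ` carrier (Div G))"

text \<open>
  \<open>Div(\<Gamma>) \<otimes> \<rat>\<close> is the \<open>\<rat>\<close>-vector space with basis \<open>V(\<Gamma>)\<close>, realised inside \<open>'a \<Rightarrow>\<^sub>0 rat\<close>;
  \<open>rat_div D\<close> is \<open>D \<otimes> 1\<close>.
\<close>

definition rat_scale :: "rat \<Rightarrow> ('a \<Rightarrow>\<^sub>0 rat) \<Rightarrow> ('a \<Rightarrow>\<^sub>0 rat)" where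
  "rat_scale c = Poly_Mapping.map ((*) c)"

definition rat_div :: "('a \<Rightarrow>\<^sub>0 int) \<Rightarrow> ('a \<Rightarrow>\<^sub>0 rat)" where
  "rat_div = Poly_Mapping.map of_int"

lemma lookup_rat_scale [simp]:
  "Poly_Mapping.lookup (rat_scale c x) v = c * Poly_Mapping.lookup x v"
  by (simp add: rat_scale_def Poly_Mapping.map.rep_eq when_def)

lemma lookup_rat_div [simp]:
  "Poly_Mapping.lookup (rat_div D) v = of_int (Poly_Mapping.lookup D v)"
  by (simp add: rat_div_def Poly_Mapping.map.rep_eq when_def)

interpretation ratvs: vector_space rat_scale
  by unfold_locales (auto intro!: poly_mapping_eqI simp: lookup_add algebra_simps)

text \<open>
  By flatness of \<open>\<rat>\<close>, \<open>Div\<^sup>0(\<Gamma>) \<otimes> \<rat>\<close> embeds into \<open>Div(\<Gamma>) \<otimes> \<rat>\<close>, with image the \<open>\<rat>\<close>-span of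
  the elements \<open>D \<otimes> 1\<close>; this image is taken as its definition. The lemmas \<open>inj_rat_div\<close> and
  \<open>Div0_rat_clear_denominators\<close> below say that it is the localisation of \<open>Div\<^sup>0(\<Gamma>)\<close> at the
  nonzero integers.
\<close>

definition Div0_rat :: "'a pair_pre_digraph \<Rightarrow> ('a \<Rightarrow>\<^sub>0 rat) set" where
  "Div0_rat G = ratvs.span (rat_div ` carrier (Div0 G))"

definition rat_laplacian :: "'a pair_pre_digraph \<Rightarrow> ('a \<Rightarrow>\<^sub>0 rat) \<Rightarrow> ('a \<Rightarrow>\<^sub>0 rat)" where
  "rat_laplacian G x =
     (\<Sum>v\<in>Poly_Mapping.keys x. rat_scale (Poly_Mapping.lookup x v) (rat_div (laplacian G (frag_of v))))"

text \<open>
  The characteristic polynomial of an endomorphism \<open>f\<close> of a finite-dimensional subspace \<open>W\<close>,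
  computed in an arbitrary ordered basis of \<open>W\<close>. For \<open>W = 0\<close> the matrix has size \<open>0\<close> and the
  polynomial is \<open>1\<close>.
\<close>

definition is_ordered_basis :: "('a \<Rightarrow>\<^sub>0 rat) list \<Rightarrow> ('a \<Rightarrow>\<^sub>0 rat) set \<Rightarrow> bool" where
  "is_ordered_basis bs W \<longleftrightarrow>
     distinct bs \<and> ratvs.independent (set bs) \<and> ratvs.span (set bs) = W"

definition endo_matrix ::
    "('a \<Rightarrow>\<^sub>0 rat) list \<Rightarrow> (('a \<Rightarrow>\<^sub>0 rat) \<Rightarrow> ('a \<Rightarrow>\<^sub>0 rat)) \<Rightarrow> rat mat" where
  "endo_matrix bs f =
     mat (length bs) (length bs) (\<lambda>(i, j). ratvs.representation (set bs) (f (bs ! j)) (bs ! i))"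

definition endo_char_poly ::
    "('a \<Rightarrow>\<^sub>0 rat) set \<Rightarrow> (('a \<Rightarrow>\<^sub>0 rat) \<Rightarrow> ('a \<Rightarrow>\<^sub>0 rat)) \<Rightarrow> rat poly" where
  "endo_char_poly W f = char_poly (endo_matrix (SOME bs. is_ordered_basis bs W) f)"

definition graph_char_poly :: "'a pair_pre_digraph \<Rightarrow> rat poly" where
  "graph_char_poly G = endo_char_poly (Div0_rat G) (rat_laplacian G)"

lemma rat_div_add: "rat_div (D + E) = rat_div D + rat_div E"
  by (rule poly_mapping_eqI) (simp add: lookup_add)

lemma rat_div_diff: "rat_div (D - E) = rat_div D - rat_div E"
  by (rule poly_mapping_eqI) (simp add: lookup_minus)

lemma rat_div_zero [simp]: "rat_div 0 = 0"
  by (rule poly_mapping_eqI) simp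

lemma rat_div_cmul: "rat_div (frag_cmul c D) = rat_scale (of_int c) (rat_div D)"
  by (rule poly_mapping_eqI) simp

lemma inj_rat_div: "inj rat_div"
  by (rule injI) (metis lookup_rat_div of_int_eq_iff poly_mapping_eqI)

lemma keys_rat_div [simp]: "Poly_Mapping.keys (rat_div D) = Poly_Mapping.keys D"
  by (auto simp: in_keys_iff)

lemma div_degree_superset:
  assumes "finite A" "Poly_Mapping.keys D \<subseteq> A"
  shows "div_degree D = (\<Sum>v\<in>A. Poly_Mapping.lookup D v)"
  unfolding div_degree_def using assms
  by (intro sum.mono_neutral_left) (auto simp: in_keys_iff)

lemma div_degree_add: "div_degree (D + E) = div_degree D + div_degree E"
proof -
  let ?A = "Poly_Mapping.keys D \<union> Poly_Mapping.keys E"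
  show ?thesis
    using keys_add[of D E]
    by (simp add: div_degree_superset[of ?A] lookup_add sum.distrib)
qed

lemma div_degree_cmul: "div_degree (frag_cmul c D) = c * div_degree D"
  using keys_cmul[of c D]
  by (simp add: div_degree_superset[of "Poly_Mapping.keys D"] sum_distrib_left)

lemma div_degree_uminus: "div_degree (- D) = - div_degree D"
  using div_degree_cmul[of "-1" D] by simp

lemma div_degree_diff: "div_degree (D - E) = div_degree D - div_degree E"
  using div_degree_add[of D "- E"] by (simp add: div_degree_uminus)

lemma div_degree_zero [simp]: "div_degree 0 = 0"
  by (simp add: div_degree_def)

lemma div_degree_frag_of [simp]: "div_degree (frag_of v) = 1"
  by (simp add: div_degree_def)

lemma div_degree_sum: "div_degree (sum f A) = (\<Sum>a\<in>A. div_degree (f a))"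
  by (induction A rule: infinite_finite_induct) (auto simp: div_degree_add)

lemma carrier_Div: "carrier (Div G) = {D. Poly_Mapping.keys D \<subseteq> pverts G}"
  by (auto simp: Div_def)

lemma carrier_Div0: "carrier (Div0 G) = {D. Poly_Mapping.keys D \<subseteq> pverts G \<and> div_degree D = 0}"
  by (auto simp: Div0_def kernel_def carrier_Div)

lemma Div0_rat_clear_denominators:
  assumes "x \<in> Div0_rat G"
  shows "\<exists>n D. n > 0 \<and> D \<in> carrier (Div0 G) \<and> rat_scale (of_int n) x = rat_div D"
  using assms unfolding Div0_rat_def
proof (induction rule: ratvs.span_induct_alt)
  case base
  show ?case
    by (rule exI[of _ 1], rule exI[of _ 0]) (auto simp: carrier_Div0)
next
  case (step c y z)
  then obtain n D E where n: "n > 0" "D \<in> carrier (Div0 G)" "rat_scale (of_int n) z = rat_div D"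
    and E: "E \<in> carrier (Div0 G)" "y = rat_div E"
    by blast
  obtain p q where "quotient_of c = (p, q)"
    by (cases "quotient_of c")
  then have pq: "q > 0" "c = of_int p / of_int q"
    by (auto simp: quotient_of_denom_pos quotient_of_div)
  let ?F = "frag_cmul (n * p) E + frag_cmul q D"
  have D: "of_int n * Poly_Mapping.lookup z v = of_int (Poly_Mapping.lookup D v)" for v
    using n(3) by (metis lookup_rat_scale lookup_rat_div)
  have "rat_scale (of_int (n * q)) (rat_scale c y + z) = rat_div ?F"
    using pq by (intro poly_mapping_eqI) (simp add: E(2) lookup_add field_simps flip: D)
  moreover have "?F \<in> carrier (Div0 G)"
    using n(2) E(1) keys_add[of "frag_cmul (n * p) E" "frag_cmul q D"]
      keys_cmul[of "n * p" E] keys_cmul[of q D]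
    by (auto simp: carrier_Div0 div_degree_add div_degree_cmul)
  ultimately show ?case
    using n(1) pq(1) by (intro exI[of _ "n * q"] exI[of _ ?F]) simp
qed

lemma rat_laplacian_superset:
  assumes "finite A" "Poly_Mapping.keys x \<subseteq> A"
  shows "rat_laplacian G x =
    (\<Sum>v\<in>A. rat_scale (Poly_Mapping.lookup x v) (rat_div (laplacian G (frag_of v))))"
  unfolding rat_laplacian_def using assms
  by (intro sum.mono_neutral_left) (auto simp: in_keys_iff)

lemma linear_rat_laplacian: "Vector_Spaces.linear rat_scale rat_scale (rat_laplacian G)"
proof (unfold_locales, goal_cases)
  case (1 x y)
  let ?A = "Poly_Mapping.keys x \<union> Poly_Mapping.keys y"
  show ?case
    using keys_add[of x y]
    by (simp add: rat_laplacian_superset[of ?A] lookup_add ratvs.scale_left_distrib sum.distrib)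
next
  case (2 c x)
  have "Poly_Mapping.keys (rat_scale c x) \<subseteq> Poly_Mapping.keys x"
    by (auto simp: in_keys_iff)
  then show ?case
    by (simp add: rat_laplacian_superset[of "Poly_Mapping.keys x"] ratvs.scale_sum_right)
qed

lemma rat_laplacian_rat_div: "rat_laplacian G (rat_div D) = rat_div (laplacian G D)"
proof -
  have *: "rat_div (sum f A) = (\<Sum>a\<in>A. rat_div (f a))" for f :: "'b \<Rightarrow> ('a \<Rightarrow>\<^sub>0 int)" and A
    by (induction A rule: infinite_finite_induct) (auto simp: rat_div_add)
  show ?thesis
    by (simp add: rat_laplacian_def laplacian_def frag_extend_def[of _ D] * rat_div_cmul)
qed

lemma (in pair_graph) laplacian_in_Div0:
  assumes "D \<in> carrier (Div G)"
  shows "laplacian G D \<in> carrier (Div0 G)"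
proof -
  let ?d = "\<lambda>v. frag_cmul (int (out_degree (with_proj G) v)) (frag_of v)
       - (\<Sum>w | (w, v) \<in> parcs G. frag_of w)"
  have deg: "out_degree (with_proj G) v = card {w. (w, v) \<in> parcs G}" for v
  proof -
    have "out_arcs (with_proj G) v = Pair v ` {w. (w, v) \<in> parcs G}"
      using pair_sym_arcs by (auto simp: out_arcs_def symmetric_def dest: symD)
    then show ?thesis
      by (simp add: out_degree_def card_image inj_on_def)
  qed
  have "div_degree (?d v) = 0" for v
    by (simp add: div_degree_diff div_degree_cmul div_degree_sum deg)
  then have "div_degree (laplacian G D) = 0"
    by (simp add: laplacian_def frag_extend_def div_degree_sum div_degree_cmul)
  moreover have "Poly_Mapping.keys (?d v) \<subseteq> pverts G" if "v \<in> pverts G" for v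
  proof -
    have "Poly_Mapping.keys (\<Sum>w | (w, v) \<in> parcs G. frag_of w) \<subseteq> pverts G"
      using keys_sum[of frag_of "{w. (w, v) \<in> parcs G}"] by (auto dest: in_arcsD1)
    then show ?thesis
      using that keys_cmul[of "int (out_degree (with_proj G) v)" "frag_of v"]
      by (intro order_trans[OF keys_diff] Un_least) (auto simp: keys_frag_of)
  qed
  then have "Poly_Mapping.keys (laplacian G D) \<subseteq> pverts G"
    using assms keys_frag_extend[of ?d D] unfolding laplacian_def carrier_Div by blast
  ultimately show ?thesis
    by (simp add: carrier_Div0)
qed

lemma (in pair_graph) rat_laplacian_in_Div0_rat:
  assumes "x \<in> Div0_rat G"
  shows "rat_laplacian G x \<in> Div0_rat G"
proof -
  interpret L: Vector_Spaces.linear rat_scale rat_scale "rat_laplacian G"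
    by (rule linear_rat_laplacian)
  have "rat_laplacian G ` rat_div ` carrier (Div0 G) \<subseteq> rat_div ` carrier (Div0 G)"
    using laplacian_in_Div0 by (auto simp: rat_laplacian_rat_div carrier_Div carrier_Div0)
  then have "rat_laplacian G ` Div0_rat G \<subseteq> Div0_rat G"
    unfolding Div0_rat_def L.span_image[symmetric] by (rule ratvs.span_mono)
  then show ?thesis
    using assms by blast
qed

lemma Div0_rat_ordered_basis:
  assumes "finite (pverts G)"
  shows "\<exists>bs. is_ordered_basis bs (Div0_rat G)"
proof -
  obtain B where B: "B \<subseteq> Div0_rat G" "ratvs.independent B" "Div0_rat G \<subseteq> ratvs.span B"
    by (rule ratvs.basis_exists) blast
  have span: "ratvs.span B = Div0_rat G"
    using B ratvs.span_minimal[OF B(1)] by (auto simp: Div0_rat_def)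
  let ?S = "(\<lambda>v. rat_div (frag_of v)) ` pverts G"
  have "rat_div D \<in> ratvs.span ?S" if "D \<in> carrier (Div0 G)" for D
  proof -
    have "Poly_Mapping.keys D \<subseteq> pverts G"
      using that by (simp add: carrier_Div0)
    then show ?thesis
      by (rule free_Abelian_group_induct)
        (auto simp: rat_div_diff intro: ratvs.span_base ratvs.span_zero ratvs.span_diff)
  qed
  then have "Div0_rat G \<subseteq> ratvs.span ?S"
    unfolding Div0_rat_def by (intro ratvs.span_minimal) auto
  then have "finite B"
    using ratvs.independent_span_bound[of ?S B] assms B(1,2) by blast
  then obtain bs where "set bs = B" "distinct bs"
    using finite_distinct_list by blast
  then show ?thesis
    using B(2) span unfolding is_ordered_basis_def by blast
qed

lemma graph_char_poly_one_vertex: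
  assumes "pverts G = {v}"
  shows "graph_char_poly G = 1"
proof -
  have "D = 0" if "Poly_Mapping.keys D \<subseteq> {v}" "div_degree D = 0" for D :: "'a \<Rightarrow>\<^sub>0 int"
  proof (rule poly_mapping_eqI)
    fix w
    show "Poly_Mapping.lookup D w = Poly_Mapping.lookup 0 w"
      using that div_degree_superset[of "{v}" D] by (cases "w = v") (auto simp: in_keys_iff)
  qed
  then have "carrier (Div0 G) \<subseteq> {0}"
    by (auto simp: carrier_Div0 assms)
  then have W: "Div0_rat G \<subseteq> {0}"
    unfolding Div0_rat_def by (intro ratvs.span_minimal) auto
  have "is_ordered_basis (SOME bs. is_ordered_basis bs (Div0_rat G)) (Div0_rat G)"
    using Div0_rat_ordered_basis[of G] assms by (auto intro: someI_ex)
  moreover have "bs = []" if "is_ordered_basis bs (Div0_rat G)" for bs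
  proof -
    have "set bs \<subseteq> {0}" "0 \<notin> set bs"
      using that W ratvs.span_superset[of "set bs"] ratvs.dependent_zero[of "set bs"]
      by (auto simp: is_ordered_basis_def)
    then show ?thesis by (cases bs) auto
  qed
  ultimately have "(SOME bs. is_ordered_basis bs (Div0_rat G)) = []"
    by blast
  then show ?thesis
    by (simp add: graph_char_poly_def endo_char_poly_def endo_matrix_def char_poly_def
        char_poly_matrix_def)
qed

end

theory Submission
  imports Defs
begin

text \<open>
  Write \<open>L\<close> for the Laplacian matrix of a graph on \<open>n\<close> vertices and \<open>J\<close> for the all-ones matrix.
  The choice of a vertex identifies \<open>Pic\<^sup>0\<close> with the cokernel of the reduced Laplacian over the
  integers, so \<open>|Pic\<^sup>0|\<close> is the absolute value of its determinant, and row and column operations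
  give \<open>det (L + J) = n\<^sup>2 det L\<^sub>r\<^sub>e\<^sub>d\<close>. For the join, \<open>L + J\<close> is block diagonal with blocks
  \<open>L\<^sub>i + (k - k\<^sub>i) I + J\<close>. Such a block acts on \<open>Div\<^sup>0(\<Gamma>\<^sub>i)\<close> as \<open>L\<^sub>i + (k - k\<^sub>i)\<close> and on the
  one-dimensional quotient by it as \<open>k\<close>, so its determinant is \<open>\<plusminus>k P\<^sub>i(k\<^sub>i - k)\<close>. Hence
  \<open>k\<^sup>2 |Pic\<^sup>0| = k\<^sup>l \<Prod> |P\<^sub>i(k\<^sub>i - k)|\<close>. Connectedness makes the quadratic form of \<open>L + J\<close>
  positive definite, so that the determinant is nonzero.
\<close>

section \<open>Cokernels of integer matrices\<close>

text \<open>A set of representatives for the cokernel of \<open>A\<close>. Counting representatives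
  instead of forming a quotient group reduces the order of the cokernel to a cardinality and allows
  coordinates to be prepended one at a time.\<close>

definition is_transversal :: "int mat \<Rightarrow> int vec set \<Rightarrow> bool" where
  "is_transversal A T \<longleftrightarrow> T \<subseteq> carrier_vec (dim_row A) \<and>
     (\<forall>x\<in>carrier_vec (dim_row A). \<exists>!t. t \<in> T \<and> (\<exists>z\<in>carrier_vec (dim_col A). x = t + A *\<^sub>v z))"

text \<open>The columns of \<open>A * E\<close> are integer combinations of those of
  \<open>A\<close>, and \<open>A = (A * E) * F\<close> gives the converse. Both matrices therefore
  have the same column lattice, so integral column operations preserve representatives.\<close>

lemma is_transversal_mult_unimodular:
  fixes A :: "int mat"
  assumes A: "A \<in> carrier_mat m n" and E: "E \<in> carrier_mat n n" and F: "F \<in> carrier_mat n n"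
    and EF: "E * F = 1\<^sub>m n" and T: "is_transversal (A * E) T"
  shows "is_transversal A T"
proof -
  have "A = (A * E) * F"
    using A E F EF by (simp add: assoc_mult_mat[of A m n E n F n])
  then have "A *\<^sub>v z = (A * E) *\<^sub>v (F *\<^sub>v z)" if "z \<in> carrier_vec n" for z
    using A E F that by (metis assoc_mult_mat_vec mult_carrier_mat)
  moreover have "(A * E) *\<^sub>v z = A *\<^sub>v (E *\<^sub>v z)" if "z \<in> carrier_vec n" for z
    using A E that by (simp add: assoc_mult_mat_vec)
  ultimately have "(\<exists>z\<in>carrier_vec n. x = t + A *\<^sub>v z) \<longleftrightarrow> (\<exists>z\<in>carrier_vec n. x = t + (A * E) *\<^sub>v z)" for x t
    using E F by (metis mult_mat_vec_carrier)
  then show ?thesis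
    using T A E by (auto simp: is_transversal_def)
qed

text \<open>When the first row is zero after its first entry d, lattice vectors have first
  coordinate in d times the integers. Division with remainder fixes the first coordinate of the
  representative; after removing the matching multiple of the first column, the rest is reduced
  modulo the lattice of the lower right block.\<close>

lemma is_transversal_vCons:
  fixes A :: "int mat"
  assumes A: "A \<in> carrier_mat (Suc m) (Suc m)"
    and zero: "\<And>j. j < m \<Longrightarrow> A $$ (0, Suc j) = 0"
    and d: "A $$ (0, 0) \<noteq> 0"
    and T: "is_transversal (mat m m (\<lambda>(i, j). A $$ (Suc i, Suc j))) T"
  shows "is_transversal A ((\<lambda>(a, t). vCons a t) ` ({0..<\<bar>A $$ (0, 0)\<bar>} \<times> T))"
proof -
  define d where "d = A $$ (0, 0)"
  define c where "c = vec m (\<lambda>i. A $$ (Suc i, 0))"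
  define M where "M = mat m m (\<lambda>(i, j). A $$ (Suc i, Suc j))"
  have c: "c \<in> carrier_vec m" and M: "M \<in> carrier_mat m m"
    by (simp_all add: c_def M_def)
  have d0: "d \<noteq> 0" using d by (simp add: d_def)
  have Tc: "T \<subseteq> carrier_vec m"
    and Tx: "\<And>x. x \<in> carrier_vec m \<Longrightarrow> \<exists>!t. t \<in> T \<and> (\<exists>z\<in>carrier_vec m. x = t + M *\<^sub>v z)"
    using T by (auto simp: is_transversal_def M_def)
  have row0: "row A 0 = vCons d (0\<^sub>v m)"
  proof (rule eq_vecI)
    fix i assume "i < dim_vec (vCons d (0\<^sub>v m))"
    then show "row A 0 $ i = vCons d (0\<^sub>v m) $ i"
      using A zero by (cases i) (auto simp: d_def)
  qed (use A in auto)
  have rowS: "row A (Suc i) = vCons (c $ i) (row M i)" if "i < m" for i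
  proof (rule eq_vecI)
    fix j assume "j < dim_vec (vCons (c $ i) (row M i))"
    then show "row A (Suc i) $ j = vCons (c $ i) (row M i) $ j"
      using A that by (cases j) (auto simp: c_def M_def)
  qed (use A M in auto)
  have Az: "A *\<^sub>v vCons a z = vCons (d * a) (a \<cdot>\<^sub>v c + M *\<^sub>v z)" if z: "z \<in> carrier_vec m" for a z
  proof (rule eq_vecI)
    fix i assume "i < dim_vec (vCons (d * a) (a \<cdot>\<^sub>v c + M *\<^sub>v z))"
    then show "(A *\<^sub>v vCons a z) $ i = vCons (d * a) (a \<cdot>\<^sub>v c + M *\<^sub>v z) $ i"
      using A M c z by (cases i) (auto simp: row0 rowS)
  qed (use A M in auto)
  have add: "vCons a t + vCons b s = vCons (a + b) (t + s)"
    if "t \<in> carrier_vec m" "s \<in> carrier_vec m" for a b :: int and t s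
  proof (rule eq_vecI)
    fix i assume "i < dim_vec (vCons (a + b) (t + s))"
    then show "(vCons a t + vCons b s) $ i = vCons (a + b) (t + s) $ i"
      using that by (cases i) auto
  qed (use that in auto)
  \<comment> \<open>The first coordinate determines the multiple \<open>y\<close> of the first
    column, which leaves a congruence for \<open>M\<close> alone.\<close>
  have ex: "(\<exists>z\<in>carrier_vec (Suc m). vCons x0 x = vCons a t + A *\<^sub>v z) \<longleftrightarrow>
      (\<exists>y. x0 = a + d * y \<and> (\<exists>z\<in>carrier_vec m. x - y \<cdot>\<^sub>v c = t + M *\<^sub>v z))" (is "?L \<longleftrightarrow> ?R")
    if x: "x \<in> carrier_vec m" and t: "t \<in> carrier_vec m" for x0 a x t
  proof -
    have move: "x = t + (y \<cdot>\<^sub>v c + M *\<^sub>v z) \<longleftrightarrow> x - y \<cdot>\<^sub>v c = t + M *\<^sub>v z" if z: "z \<in> carrier_vec m" for y z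
    proof -
      have "M *\<^sub>v z \<in> carrier_vec m" using M z by simp
      then show ?thesis using x t c by (auto simp: vec_eq_iff algebra_simps)
    qed
    have "?L \<longleftrightarrow> (\<exists>y. \<exists>z\<in>carrier_vec m. vCons x0 x = vCons a t + A *\<^sub>v vCons y z)"
    proof
      assume ?L
      then obtain w where w: "w \<in> carrier_vec (Suc m)" "vCons x0 x = vCons a t + A *\<^sub>v w" by blast
      then show "\<exists>y. \<exists>z\<in>carrier_vec m. vCons x0 x = vCons a t + A *\<^sub>v vCons y z"
        by (cases w) auto
    qed (metis vCons_carrier_vec)
    also have "\<dots> \<longleftrightarrow> (\<exists>y. \<exists>z\<in>carrier_vec m. x0 = a + d * y \<and> x = t + (y \<cdot>\<^sub>v c + M *\<^sub>v z))"
      using t c M by (auto simp: Az add)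
    also have "\<dots> \<longleftrightarrow> ?R"
      using move by blast
    finally show ?thesis .
  qed
  have "\<exists>!s. s \<in> (\<lambda>(a, t). vCons a t) ` ({0..<\<bar>d\<bar>} \<times> T) \<and> (\<exists>z\<in>carrier_vec (Suc m). w = s + A *\<^sub>v z)"
    if w: "w \<in> carrier_vec (Suc m)" for w
  proof -
    obtain x0 x where wx: "w = vCons x0 x" "x \<in> carrier_vec m"
      using w by (cases w) auto
    \<comment> \<open>The sign makes \<open>d * y\<close> equal to the multiple of
      \<open>\<bar>d\<bar>\<close> below \<open>x0\<close>, so the remainder lies in the required
      interval for negative \<open>d\<close> too.\<close>
    define y where "y = sgn d * (x0 div \<bar>d\<bar>)"
    have y: "x0 = x0 mod \<bar>d\<bar> + d * y"
      using d0 unfolding y_def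
      by (metis abs_sgn add.commute mult.assoc mult_div_mod_eq)
    have uniq: "a = x0 mod \<bar>d\<bar> \<and> y' = y" if "0 \<le> a" "a < \<bar>d\<bar>" "x0 = a + d * y'" for a y'
    proof -
      have "x0 mod \<bar>d\<bar> = a mod \<bar>d\<bar>"
        using that(3) by (metis abs_dvd_iff dvd_triv_left mod_add_self2 mod_eq_dvd_iff add_diff_cancel_left')
      then have "a = x0 mod \<bar>d\<bar>" using that by simp
      moreover from this have "d * y' = d * y" using that(3) y by linarith
      ultimately show ?thesis using d0 by simp
    qed
    have bound: "0 \<le> x0 mod \<bar>d\<bar>" "x0 mod \<bar>d\<bar> < \<bar>d\<bar>" using d0 by simp_all
    have xy: "x - y \<cdot>\<^sub>v c \<in> carrier_vec m" using wx c by simp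
    from Tx[OF xy] obtain t where t: "t \<in> T" "\<exists>z\<in>carrier_vec m. x - y \<cdot>\<^sub>v c = t + M *\<^sub>v z"
      and tu: "\<And>t'. t' \<in> T \<Longrightarrow> \<exists>z\<in>carrier_vec m. x - y \<cdot>\<^sub>v c = t' + M *\<^sub>v z \<Longrightarrow> t' = t"
      by metis
    show ?thesis
    proof (rule ex1I[of _ "vCons (x0 mod \<bar>d\<bar>) t"])
      show "vCons (x0 mod \<bar>d\<bar>) t \<in> (\<lambda>(a, t). vCons a t) ` ({0..<\<bar>d\<bar>} \<times> T) \<and>
        (\<exists>z\<in>carrier_vec (Suc m). w = vCons (x0 mod \<bar>d\<bar>) t + A *\<^sub>v z)"
        using t bound y Tc wx(2) unfolding wx(1) by (subst ex) auto
    next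
      fix s assume s: "s \<in> (\<lambda>(a, t). vCons a t) ` ({0..<\<bar>d\<bar>} \<times> T) \<and> (\<exists>z\<in>carrier_vec (Suc m). w = s + A *\<^sub>v z)"
      then obtain a t' where at: "s = vCons a t'" "0 \<le> a" "a < \<bar>d\<bar>" "t' \<in> T" by auto
      then obtain y' where y': "x0 = a + d * y'" "\<exists>z\<in>carrier_vec m. x - y' \<cdot>\<^sub>v c = t' + M *\<^sub>v z"
        using s ex[of x t' x0 a] wx Tc by auto
      have "a = x0 mod \<bar>d\<bar>" "y' = y" using uniq[OF at(2,3) y'(1)] by auto
      then show "s = vCons (x0 mod \<bar>d\<bar>) t" using at tu y' by auto
    qed
  qed
  then show ?thesis
    using A Tc by (auto simp: is_transversal_def d_def)
qed

lemma det_first_row_zero: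
  fixes A :: "'a :: idom mat"
  assumes A: "A \<in> carrier_mat (Suc m) (Suc m)"
    and zero: "\<And>j. j < m \<Longrightarrow> A $$ (0, Suc j) = 0"
  shows "det A = A $$ (0, 0) * det (mat m m (\<lambda>(i, j). A $$ (Suc i, Suc j)))"
proof -
  let ?D = "mat 1 1 (\<lambda>_. A $$ (0, 0))"
  have "A = four_block_mat ?D (0\<^sub>m 1 m) (mat m 1 (\<lambda>(i, j). A $$ (Suc i, 0)))
      (mat m m (\<lambda>(i, j). A $$ (Suc i, Suc j)))" (is "_ = ?B")
  proof (rule eq_matI)
    fix i j assume "i < dim_row ?B" "j < dim_col ?B"
    then show "A $$ (i, j) = ?B $$ (i, j)"
      using zero[of "j - 1"] by (cases i; cases j) auto
  qed (use A in auto)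
  then have "det A = det ?B" by simp
  also have "\<dots> = det ?D * det (mat m m (\<lambda>(i, j). A $$ (Suc i, Suc j)))"
    by (rule det_four_block_mat_upper_right_zero) auto
  finally show ?thesis by (simp add: det_single)
qed

text \<open>The Euclidean algorithm on columns clears the first row up to its first entry.\<close>

lemma int_mat_transversal:
  fixes A :: "int mat"
  assumes "A \<in> carrier_mat m m" "det A \<noteq> 0"
  shows "\<exists>T. is_transversal A T \<and> finite T \<and> int (card T) = \<bar>det A\<bar>"
  using assms
proof (induction m arbitrary: A)
  case 0
  \<comment> \<open>In dimension zero there is a single vector, and the empty determinant is
    1.\<close>
  have "is_transversal A {vNil}"
    using 0 by (auto simp: is_transversal_def intro!: bexI[of _ vNil] eq_vecI)
  then show ?case using 0 by (intro exI[of _ "{vNil}"]) auto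
next
  case (Suc m)
  note outer = Suc.IH
  show ?case
    using Suc.prems
  \<comment> \<open>For fixed dimension, the inner induction is on the total absolute value of the
    first row; \<open>outer\<close> handles the smaller block once that row is cleared.\<close>
  proof (induction "\<Sum>j<Suc m. nat \<bar>A $$ (0, j)\<bar>" arbitrary: A rule: less_induct)
    case less
    note A = \<open>A \<in> carrier_mat (Suc m) (Suc m)\<close>
    show ?case
    proof (cases "\<exists>j j'. j < Suc m \<and> j' < Suc m \<and> j \<noteq> j' \<and> A $$ (0, j) \<noteq> 0 \<and> \<bar>A $$ (0, j)\<bar> \<le> \<bar>A $$ (0, j')\<bar>")
      case True
      then obtain j j' where j: "j < Suc m" "j' < Suc m" "j \<noteq> j'" "A $$ (0, j) \<noteq> 0"
        "\<bar>A $$ (0, j)\<bar> \<le> \<bar>A $$ (0, j')\<bar>" by blast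
      \<comment> \<open>With these signs, adding \<open>a\<close> times column \<open>j\<close> to
        column \<open>j'\<close> lowers the absolute value of the first-row entry at
        \<open>j'\<close> by exactly that of the nonzero entry at \<open>j\<close>.\<close>
      define a where "a = - sgn (A $$ (0, j)) * sgn (A $$ (0, j'))"
      define B where "B = addcol a j' j A"
      have B: "B \<in> carrier_mat (Suc m) (Suc m)" using A by (auto simp: B_def)
      have BE: "B = A * addrow_mat (Suc m) a j j'"
        unfolding B_def using A j(1) by (rule addcol_mat)
      have det: "det B = det A"
        unfolding B_def using j A by (intro det_addcol) auto
      have B0: "B $$ (0, i) = (if i = j' then a * A $$ (0, j) + A $$ (0, j') else A $$ (0, i))" if "i < Suc m" for i
        using A that by (auto simp: B_def)
      have lt: "\<bar>a * A $$ (0, j) + A $$ (0, j')\<bar> < \<bar>A $$ (0, j')\<bar>"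
        using j(4,5) unfolding a_def by (auto simp: sgn_if abs_if split: if_splits)
      have "(\<Sum>j<Suc m. nat \<bar>B $$ (0, j)\<bar>) < (\<Sum>j<Suc m. nat \<bar>A $$ (0, j)\<bar>)"
        using j lt by (intro sum_strict_mono_ex1) (auto simp: B0 intro!: bexI[of _ j'])
      then obtain T where T: "is_transversal B T" "finite T" "int (card T) = \<bar>det B\<bar>"
        using less.hyps[OF _ B] less.prems det by auto
      have "is_transversal A T"
        using is_transversal_mult_unimodular[OF A _ _ addrow_mat_inv[OF j(1,2,3)]] T(1) BE by simp
      then show ?thesis using T det by auto
    next
      case False
      \<comment> \<open>Two nonzero entries are always comparable in absolute value, so one of them
        could still reduce the other.\<close>
      have "\<exists>j0<Suc m. \<forall>j<Suc m. j \<noteq> j0 \<longrightarrow> A $$ (0, j) = 0"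
      proof (rule ccontr)
        assume *: "\<not> ?thesis"
        then obtain j where j: "j < Suc m" "A $$ (0, j) \<noteq> 0" by blast
        with * obtain j' where j': "j' < Suc m" "A $$ (0, j') \<noteq> 0" "j' \<noteq> j" by blast
        then show False using j j' False linear[of "\<bar>A $$ (0, j)\<bar>" "\<bar>A $$ (0, j')\<bar>"] by metis
      qed
      then obtain j0 where j0: "j0 < Suc m" "\<And>j. j < Suc m \<Longrightarrow> j \<noteq> j0 \<Longrightarrow> A $$ (0, j) = 0" by blast
      define B where "B = swapcols 0 j0 A"
      have B: "B \<in> carrier_mat (Suc m) (Suc m)" using A by (auto simp: B_def)
      have BE: "B = A * swaprows_mat (Suc m) 0 j0"
        unfolding B_def using A j0 by (intro swapcols_mat) auto
      have zero: "B $$ (0, Suc j) = 0" if "j < m" for j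
        using A that j0 by (auto simp: B_def)
      \<comment> \<open>For \<open>j0 = 0\<close> the swap is the identity; otherwise it changes the
        sign, which the absolute value absorbs.\<close>
      have det: "\<bar>det B\<bar> = \<bar>det A\<bar>"
      proof (cases "j0 = 0")
        case True
        then have "B = A" unfolding B_def using A by (intro eq_matI) auto
        then show ?thesis by simp
      next
        case False
        then show ?thesis unfolding B_def using det_swapcols[of 0 "Suc m" j0 A] A j0 by simp
      qed
      define M where "M = mat m m (\<lambda>(i, j). B $$ (Suc i, Suc j))"
      have dB: "det B = B $$ (0, 0) * det M"
        unfolding M_def by (rule det_first_row_zero[OF B zero])
      with det less.prems have nz: "B $$ (0, 0) \<noteq> 0" "det M \<noteq> 0" by auto
      obtain T where T: "is_transversal M T" "finite T" "int (card T) = \<bar>det M\<bar>"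
        using outer[of M] nz by (auto simp: M_def)
      let ?T = "(\<lambda>(a, t). vCons a t) ` ({0..<\<bar>B $$ (0, 0)\<bar>} \<times> T)"
      have tB: "is_transversal B ?T"
        using is_transversal_vCons[OF B zero nz(1)] T(1) by (simp add: M_def)
      have "is_transversal A ?T"
        using is_transversal_mult_unimodular[OF A _ _ swaprows_mat_inv[of 0 "Suc m" j0]] j0(1) tB BE by simp
      moreover have "int (card ?T) = \<bar>det A\<bar>"
        using T det by (subst card_image) (auto simp: inj_on_def card_cartesian_product dB abs_mult)
      ultimately show ?thesis using T(2) by blast
    qed
  qed
qed

section \<open>Matrices indexed by lists\<close>

lemma det_first_col_zero:
  fixes A :: "'a :: idom mat"
  assumes A: "A \<in> carrier_mat (Suc m) (Suc m)"
    and zero: "\<And>i. i < m \<Longrightarrow> A $$ (Suc i, 0) = 0"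
  shows "det A = A $$ (0, 0) * det (mat m m (\<lambda>(i, j). A $$ (Suc i, Suc j)))"
proof -
  have T: "transpose_mat A \<in> carrier_mat (Suc m) (Suc m)" using A by simp
  have "det A = det (transpose_mat A)" using det_transpose[OF A] by simp
  also have "\<dots> = transpose_mat A $$ (0, 0) * det (mat m m (\<lambda>(i, j). transpose_mat A $$ (Suc i, Suc j)))"
    using A zero by (intro det_first_row_zero[OF T]) auto
  also have "mat m m (\<lambda>(i, j). transpose_mat A $$ (Suc i, Suc j)) = transpose_mat (mat m m (\<lambda>(i, j). A $$ (Suc i, Suc j)))"
    using A by (intro eq_matI) auto
  finally show ?thesis using A by (simp add: det_transpose[of _ m])
qed

text \<open>The list fixes an order of the vertices, while the entries stay a function of vertices.
  Concatenated lists then correspond to block matrices, and removing the head of the list gives the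
  reduced matrix.\<close>

definition list_mat :: "'a list \<Rightarrow> ('a \<Rightarrow> 'a \<Rightarrow> 'b) \<Rightarrow> 'b mat" where
  "list_mat xs f = mat (length xs) (length xs) (\<lambda>(i, j). f (xs ! i) (xs ! j))"

lemma list_mat_carrier [simp]: "list_mat xs f \<in> carrier_mat (length xs) (length xs)"
  by (simp add: list_mat_def)

lemma index_list_mat [simp]:
  "i < length xs \<Longrightarrow> j < length xs \<Longrightarrow> list_mat xs f $$ (i, j) = f (xs ! i) (xs ! j)"
  "dim_row (list_mat xs f) = length xs" "dim_col (list_mat xs f) = length xs"
  by (simp_all add: list_mat_def)

lemma list_mat_cong:
  "(\<And>x y. x \<in> set xs \<Longrightarrow> y \<in> set xs \<Longrightarrow> f x y = g x y) \<Longrightarrow> list_mat xs f = list_mat xs g"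
  by (auto intro!: eq_matI)

lemma list_mat_map: "list_mat (map h xs) f = list_mat xs (\<lambda>x y. f (h x) (h y))"
  by (auto intro!: eq_matI)

lemma det_list_mat_append:
  fixes f :: "'a \<Rightarrow> 'a \<Rightarrow> 'b :: idom"
  assumes "\<And>x y. x \<in> set xs \<Longrightarrow> y \<in> set ys \<Longrightarrow> f x y = 0"
  shows "det (list_mat (xs @ ys) f) = det (list_mat xs f) * det (list_mat ys f)"
proof -
  let ?C = "mat (length ys) (length xs) (\<lambda>(i, j). f (ys ! i) (xs ! j))"
  have "list_mat (xs @ ys) f =
      four_block_mat (list_mat xs f) (0\<^sub>m (length xs) (length ys)) ?C (list_mat ys f)"
    by (rule eq_matI) (auto simp: nth_append assms)
  then show ?thesis
    by (simp add: det_four_block_mat_upper_right_zero[of _ "length xs" _ "length ys"])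
qed

lemma det_list_mat_concat:
  fixes f :: "'a \<Rightarrow> 'a \<Rightarrow> 'b :: idom"
  assumes "distinct is"
    and "\<And>i j x y. i \<in> set is \<Longrightarrow> j \<in> set is \<Longrightarrow> i \<noteq> j \<Longrightarrow> x \<in> set (xs i) \<Longrightarrow> y \<in> set (xs j) \<Longrightarrow> f x y = 0"
  shows "det (list_mat (concat (map xs is)) f) = (\<Prod>i\<in>set is. det (list_mat (xs i) f))"
  using assms
proof (induction "is")
  case Nil
  then show ?case by (simp add: det_dim_zero list_mat_def)
next
  case (Cons i "is")
  have "det (list_mat (concat (map xs (i # is))) f) =
      det (list_mat (xs i) f) * det (list_mat (concat (map xs is)) f)"
    unfolding list.map concat.simps using Cons.prems by (intro det_list_mat_append) auto
  also have "det (list_mat (concat (map xs is)) f) = (\<Prod>i\<in>set is. det (list_mat (xs i) f))"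
    using Cons.prems by (intro Cons.IH) auto
  finally show ?case using Cons.prems(1) by simp
qed

lemma sum_nth_distinct:
  "distinct xs \<Longrightarrow> (\<Sum>i = 0..<length xs. g (xs ! i)) = sum g (set xs)"
  using sum.reindex_bij_betw[OF bij_betw_nth[of xs "{0..<length xs}" "set xs"], of g]
  by (simp add: atLeast0LessThan)

lemma mult_mat_index_sum:
  assumes "i < dim_row A" "j < dim_col B" "dim_col A = dim_row B"
  shows "(A * B) $$ (i, j) = (\<Sum>k = 0..<dim_row B. A $$ (i, k) * B $$ (k, j))"
  using assms by (simp add: scalar_prod_def)

text \<open>Adding all rows to the first one and then all columns to the first one turns the
  matrix \<open>f + 1\<close> into a product of two block triangular matrices.\<close>

lemma det_list_mat_plus_one:
  fixes f :: "'a \<Rightarrow> 'a \<Rightarrow> 'b :: idom"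
  assumes dist: "distinct (v # vs)"
    and rows: "\<And>x. x \<in> set (v # vs) \<Longrightarrow> (\<Sum>y\<in>set (v # vs). f x y) = 0"
    and cols: "\<And>y. y \<in> set (v # vs) \<Longrightarrow> (\<Sum>x\<in>set (v # vs). f x y) = 0"
  shows "det (list_mat (v # vs) (\<lambda>x y. f x y + 1)) = of_nat (length (v # vs)) ^ 2 * det (list_mat vs f)"
proof -
  define xs where "xs = v # vs"
  define n where "n = length xs"
  have n: "n = Suc (length vs)" by (simp add: n_def xs_def)
  have rows': "(\<Sum>k = 0..<n. f (xs ! i) (xs ! k)) = 0" if "i < n" for i
    using sum_nth_distinct[of xs "f (xs ! i)"] dist rows[of "xs ! i"] nth_mem[of i xs] that
    unfolding xs_def n_def by simp
  have cols': "(\<Sum>k = 0..<n. f (xs ! k) (xs ! j)) = 0" if "j < n" for j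
    using sum_nth_distinct[of xs "\<lambda>x. f x (xs ! j)"] dist cols[of "xs ! j"] nth_mem[of j xs] that
    unfolding xs_def n_def by simp
  define N where "N = list_mat xs (\<lambda>x y. f x y + 1)"
  \<comment> \<open>Multiplication by \<open>P\<close> on the left adds all rows to the first one;
    multiplication by its transpose on the right does the same for columns.\<close>
  define P where "P = mat n n (\<lambda>(i, j). if i = 0 \<or> i = j then 1 else 0 :: 'b)"
  \<comment> \<open>Since column sums of \<open>f\<close> vanish, the first row of
    \<open>P * N\<close> is constantly \<open>n\<close>. Division by \<open>n\<close> may be
    impossible in \<open>'b\<close>, so \<open>X\<close> carries this factor; its column of ones
    adds the first row of \<open>Z\<close> back to the other rows.\<close>
  define X where "X = mat n n (\<lambda>(i, j). (if j = 0 then if i = 0 then of_nat n else 1 else 0) + (if i = j \<and> i \<noteq> 0 then 1 else 0) :: 'b)"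
  define Z where "Z = mat n n (\<lambda>(i, j). if i = 0 then 1 else f (xs ! i) (xs ! j))"
  \<comment> \<open>\<open>Y\<close> is \<open>Z\<close> with all columns added to the first. The
    row sums of \<open>f\<close> vanish, so below the corner \<open>n\<close> the first column is
    zero; this yields the second factor \<open>n\<close>.\<close>
  define Y where "Y = mat n n (\<lambda>(i, j). if i = 0 then if j = 0 then of_nat n else 1 else if j = 0 then 0 else f (xs ! i) (xs ! j))"
  have carr: "N \<in> carrier_mat n n" "P \<in> carrier_mat n n" "X \<in> carrier_mat n n" "Z \<in> carrier_mat n n" "Y \<in> carrier_mat n n"
    by (simp_all add: N_def P_def X_def Y_def Z_def n_def)
  have Nij: "N $$ (i, j) = f (xs ! i) (xs ! j) + 1" if "i < n" "j < n" for i j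
    using that by (simp add: N_def n_def)
  have "P * N = X * Z"
  proof (rule eq_matI)
    fix i j assume "i < dim_row (X * Z)" "j < dim_col (X * Z)"
    then have ij: "i < n" "j < n" using carr by auto
    have L: "(P * N) $$ (i, j) = (if i = 0 then of_nat n else f (xs ! i) (xs ! j) + 1)"
    proof (cases "i = 0")
      case True
      then show ?thesis
        using ij carr by (simp del: index_mult_mat(1) add: mult_mat_index_sum P_def Nij sum.distrib cols')
    next
      case False
      then show ?thesis
        using ij carr by (simp del: index_mult_mat(1) add: mult_mat_index_sum P_def Nij if_distrib[of "\<lambda>x. x * _"] cong: if_cong)
    qed
    have R: "(X * Z) $$ (i, j) = (if i = 0 then of_nat n else f (xs ! i) (xs ! j) + 1)"
    proof (cases "i = 0")
      case True
      then show ?thesis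
        using ij carr by (simp del: index_mult_mat(1) add: mult_mat_index_sum X_def Z_def if_distrib[of "\<lambda>x. x * _"] cong: if_cong)
    next
      case False
      then show ?thesis
        using ij carr by (simp del: index_mult_mat(1) add: mult_mat_index_sum X_def Z_def distrib_right sum.distrib if_distrib[of "\<lambda>x. x * _"] cong: if_cong)
    qed
    show "(P * N) $$ (i, j) = (X * Z) $$ (i, j)" using L R by simp
  qed (use carr in auto)
  then have 1: "det P * det N = det X * det Z"
    using carr by (metis det_mult)
  have "Z * transpose_mat P = Y"
  proof (rule eq_matI)
    fix i j assume "i < dim_row Y" "j < dim_col Y"
    then have ij: "i < n" "j < n" using carr by auto
    show "(Z * transpose_mat P) $$ (i, j) = Y $$ (i, j)"
    proof (cases "j = 0")
      case True
      then show ?thesis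
        using ij carr rows' by (simp del: index_mult_mat(1) add: mult_mat_index_sum P_def Z_def Y_def)
    next
      case False
      then show ?thesis
        using ij carr by (simp del: index_mult_mat(1) add: mult_mat_index_sum P_def Z_def Y_def if_distrib[of "\<lambda>x. _ * x"] cong: if_cong)
    qed
  qed (use carr in auto)
  then have 2: "det Z * det P = det Y"
    using carr det_mult[of Z n "transpose_mat P"] det_transpose[of P n] by simp
  have "det P = P $$ (0, 0) * det (mat (length vs) (length vs) (\<lambda>(i, j). P $$ (Suc i, Suc j)))"
    using carr n by (intro det_first_col_zero) (auto simp: P_def)
  also have "mat (length vs) (length vs) (\<lambda>(i, j). P $$ (Suc i, Suc j)) = 1\<^sub>m (length vs)"
    using n by (intro eq_matI) (auto simp: P_def)
  finally have P: "det P = 1" using n by (simp add: P_def)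
  have "det X = X $$ (0, 0) * det (mat (length vs) (length vs) (\<lambda>(i, j). X $$ (Suc i, Suc j)))"
    using carr n by (intro det_first_row_zero) (auto simp: X_def)
  also have "mat (length vs) (length vs) (\<lambda>(i, j). X $$ (Suc i, Suc j)) = 1\<^sub>m (length vs)"
    using n by (intro eq_matI) (auto simp: X_def)
  finally have X: "det X = of_nat n" using n by (simp add: X_def)
  have "det Y = Y $$ (0, 0) * det (mat (length vs) (length vs) (\<lambda>(i, j). Y $$ (Suc i, Suc j)))"
    using carr n by (intro det_first_col_zero) (auto simp: Y_def)
  also have "mat (length vs) (length vs) (\<lambda>(i, j). Y $$ (Suc i, Suc j)) = list_mat vs f"
    using n by (intro eq_matI) (auto simp: Y_def xs_def)
  finally have Y: "det Y = of_nat n * det (list_mat vs f)" using n by (simp add: Y_def)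
  show ?thesis
    using 1 2 unfolding P X Y N_def n_def xs_def by (simp add: power2_eq_square ac_simps)
qed

section \<open>Characteristic polynomial of the rational Laplacian\<close>

lemma ratvs_independent_nth:
  assumes "distinct bs" "ratvs.independent (set bs)"
    and "(\<Sum>j = 0..<length bs. rat_scale (c j) (bs ! j)) = 0" "j < length bs"
  shows "c j = 0"
proof -
  define g where "g = (\<lambda>b. c (inv_into {0..<length bs} ((!) bs) b))"
  have inj: "inj_on ((!) bs) {0..<length bs}"
    using assms(1) by (auto simp: inj_on_def nth_eq_iff_index_eq)
  have g: "g (bs ! i) = c i" if "i < length bs" for i
    unfolding g_def using inj that by (simp add: inv_into_f_f)
  have "(\<Sum>b\<in>set bs. rat_scale (g b) b) = (\<Sum>j = 0..<length bs. rat_scale (g (bs ! j)) (bs ! j))"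
    by (rule sum_nth_distinct[OF assms(1), symmetric])
  also have "\<dots> = 0" using assms(3) by (simp add: g)
  finally have "g (bs ! j) = 0"
    using ratvs.independentD[OF assms(2) finite_set subset_refl] assms(4) by simp
  then show ?thesis using g assms(4) by simp
qed

abbreviation unit_div :: "'a \<Rightarrow> ('a \<Rightarrow>\<^sub>0 rat)" where
  "unit_div v \<equiv> Poly_Mapping.single v 1"

lemma lookup_sum_unit_div:
  assumes "finite V"
  shows "Poly_Mapping.lookup (\<Sum>v\<in>V. rat_scale (f v) (unit_div v)) u = (if u \<in> V then f u else 0)"
  using assms by (simp add: lookup_sum lookup_single when_def if_distrib[of "\<lambda>x. _ * x"] cong: if_cong)

lemma unit_div_expansion:
  assumes "finite V" "Poly_Mapping.keys x \<subseteq> V"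
  shows "x = (\<Sum>v\<in>V. rat_scale (Poly_Mapping.lookup x v) (unit_div v))"
proof (rule poly_mapping_eqI)
  fix u
  show "Poly_Mapping.lookup x u =
      Poly_Mapping.lookup (\<Sum>v\<in>V. rat_scale (Poly_Mapping.lookup x v) (unit_div v)) u"
    using assms by (auto simp: lookup_sum_unit_div in_keys_iff)
qed

lemma subspace_keys: "ratvs.subspace {x. Poly_Mapping.keys x \<subseteq> V}"
proof (rule ratvs.subspaceI)
  fix x y :: "'a \<Rightarrow>\<^sub>0 rat"
  assume "x \<in> {x. Poly_Mapping.keys x \<subseteq> V}" "y \<in> {x. Poly_Mapping.keys x \<subseteq> V}"
  then show "x + y \<in> {x. Poly_Mapping.keys x \<subseteq> V}" using keys_add[of x y] by blast
qed (auto simp: in_keys_iff)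

text \<open>The vertices form a second basis of the same space; comparing an independent set with a
  spanning set in both directions gives equal lengths.\<close>

lemma length_basis_keys:
  assumes "distinct vs" "is_ordered_basis bs {x. Poly_Mapping.keys x \<subseteq> set vs}"
  shows "length bs = length vs"
proof -
  let ?E = "unit_div ` set vs"
  have cE: "card ?E = length vs"
    using assms(1) by (subst card_image) (auto simp: inj_on_def distinct_card dest: arg_cong[of _ _ Poly_Mapping.keys])
  have cb: "card (set bs) = length bs" using assms(2) by (simp add: is_ordered_basis_def distinct_card)
  have indep: "ratvs.independent ?E"
  proof (rule ratvs.independent_if_scalars_zero)
    fix f x assume s: "(\<Sum>x\<in>?E. rat_scale (f x) x) = 0" and "x \<in> ?E"
    then obtain v where v: "v \<in> set vs" "x = unit_div v" by blast
    have "(\<Sum>x\<in>?E. rat_scale (f x) x) = (\<Sum>v\<in>set vs. rat_scale (f (unit_div v)) (unit_div v))"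
      by (subst sum.reindex) (auto simp: inj_on_def dest: arg_cong[of _ _ Poly_Mapping.keys])
    then have "Poly_Mapping.lookup (\<Sum>v\<in>set vs. rat_scale (f (unit_div v)) (unit_div v)) v = 0"
      using s by simp
    then show "f x = 0" using v by (simp add: lookup_sum_unit_div)
  qed simp
  have "?E \<subseteq> ratvs.span (set bs)"
    using assms(2) by (auto simp: is_ordered_basis_def)
  then have "length vs \<le> length bs"
    using ratvs.independent_span_bound[OF finite_set[of bs] indep] cE cb by simp
  moreover have "set bs \<subseteq> ratvs.span ?E"
  proof
    fix b assume "b \<in> set bs"
    then have "Poly_Mapping.keys b \<subseteq> set vs"
      using assms(2) ratvs.span_superset[of "set bs"] by (auto simp: is_ordered_basis_def)
    note b = unit_div_expansion[OF finite_set this]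
    show "b \<in> ratvs.span ?E"
      by (subst b) (intro ratvs.span_sum ratvs.span_scale ratvs.span_base imageI)
  qed
  then have "length bs \<le> length vs"
    using ratvs.independent_span_bound[of ?E "set bs"] assms(2) cE cb by (simp add: is_ordered_basis_def)
  ultimately show ?thesis by simp
qed

text \<open>The matrix \<open>Q\<close> of vertex coordinates of the basis vectors intertwines the
  two matrices, and it is invertible. This permits a determinant given by vertices to be computed in
  a basis adapted to \<open>Div0_rat\<close>.\<close>

lemma det_list_mat_eq_det_endo_matrix:
  assumes vs: "distinct vs" and bs: "is_ordered_basis bs {x. Poly_Mapping.keys x \<subseteq> set vs}"
    and keys: "\<And>x. Poly_Mapping.keys x \<subseteq> set vs \<Longrightarrow> Poly_Mapping.keys (F x) \<subseteq> set vs"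
    and F: "\<And>x u. Poly_Mapping.keys x \<subseteq> set vs \<Longrightarrow> u \<in> set vs \<Longrightarrow>
      Poly_Mapping.lookup (F x) u = (\<Sum>v\<in>set vs. N u v * Poly_Mapping.lookup x v)"
  shows "det (list_mat vs N) = det (endo_matrix bs F)"
proof -
  define n where "n = length vs"
  have len: "length bs = n" unfolding n_def using length_basis_keys[OF vs bs] .
  have bd: "distinct bs" "ratvs.independent (set bs)"
    and bspan: "ratvs.span (set bs) = {x. Poly_Mapping.keys x \<subseteq> set vs}"
    using bs by (auto simp: is_ordered_basis_def)
  have bk: "Poly_Mapping.keys (bs ! j) \<subseteq> set vs" if "j < n" for j
    using that len bspan ratvs.span_base[of "bs ! j" "set bs"] nth_mem[of j bs] by auto
  define Q where "Q = mat n n (\<lambda>(i, j). Poly_Mapping.lookup (bs ! j) (vs ! i))"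
  let ?N = "list_mat vs N" and ?B = "endo_matrix bs F"
  have carr: "Q \<in> carrier_mat n n" "?N \<in> carrier_mat n n" "?B \<in> carrier_mat n n"
    by (simp_all add: Q_def n_def list_mat_def endo_matrix_def len[unfolded n_def])
  have "?N * Q = Q * ?B"
  proof (rule eq_matI)
    fix i j assume "i < dim_row (Q * ?B)" "j < dim_col (Q * ?B)"
    then have ij: "i < n" "j < n" using carr by auto
    have vi: "vs ! i \<in> set vs" using ij by (simp add: n_def)
    have "(?N * Q) $$ (i, j) = (\<Sum>k = 0..<n. N (vs ! i) (vs ! k) * Poly_Mapping.lookup (bs ! j) (vs ! k))"
      using ij carr by (simp del: index_mult_mat(1) add: mult_mat_index_sum Q_def n_def)
    also have "\<dots> = Poly_Mapping.lookup (F (bs ! j)) (vs ! i)"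
      using sum_nth_distinct[OF vs, of "\<lambda>v. N (vs ! i) v * Poly_Mapping.lookup (bs ! j) v"]
      by (simp add: F[OF bk[OF ij(2)] vi] n_def)
    also have "F (bs ! j) = (\<Sum>b\<in>set bs. rat_scale (ratvs.representation (set bs) (F (bs ! j)) b) b)"
      using keys[OF bk[OF ij(2)]] by (intro ratvs.sum_representation_eq[symmetric, OF bd(2)]) (simp_all add: bspan)
    also have "Poly_Mapping.lookup \<dots> (vs ! i) =
        (\<Sum>b\<in>set bs. ratvs.representation (set bs) (F (bs ! j)) b * Poly_Mapping.lookup b (vs ! i))"
      by (simp add: lookup_sum)
    also have "\<dots> = (\<Sum>k = 0..<n. ratvs.representation (set bs) (F (bs ! j)) (bs ! k) * Poly_Mapping.lookup (bs ! k) (vs ! i))"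
      using sum_nth_distinct[OF bd(1), of "\<lambda>b. ratvs.representation (set bs) (F (bs ! j)) b * Poly_Mapping.lookup b (vs ! i)"] len
      by simp
    also have "\<dots> = (Q * ?B) $$ (i, j)"
      using ij carr len by (simp del: index_mult_mat(1) add: mult_mat_index_sum Q_def endo_matrix_def mult.commute)
    finally show "(?N * Q) $$ (i, j) = (Q * ?B) $$ (i, j)" .
  qed (use carr in auto)
  then have "det ?N * det Q = det Q * det ?B"
    using carr by (metis det_mult)
  \<comment> \<open>A kernel vector of \<open>Q\<close> would be a nontrivial linear relation
    between the members of \<open>bs\<close>.\<close>
  moreover have "det Q \<noteq> 0"
  proof
    assume "det Q = 0"
    then obtain w where w: "w \<in> carrier_vec n" "w \<noteq> 0\<^sub>v n" "Q *\<^sub>v w = 0\<^sub>v n"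
      using det_0_iff_vec_prod_zero_field[OF carr(1)] by blast
    have "(\<Sum>j = 0..<length bs. rat_scale (w $ j) (bs ! j)) = 0"
    proof (rule poly_mapping_eqI)
      fix u
      show "Poly_Mapping.lookup (\<Sum>j = 0..<length bs. rat_scale (w $ j) (bs ! j)) u = Poly_Mapping.lookup 0 u"
      proof (cases "u \<in> set vs")
        case True
        then obtain i where i: "i < n" "u = vs ! i" by (auto simp: in_set_conv_nth n_def)
        have "(Q *\<^sub>v w) $ i = 0" using w(3) i by simp
        then show ?thesis
          using i w(1) carr(1) by (simp add: lookup_sum scalar_prod_def Q_def len mult.commute)
      next
        case False
        then have "Poly_Mapping.lookup (bs ! j) u = 0" if "j < n" for j
          using bk[OF that] by (auto simp: in_keys_iff)
        then show ?thesis by (simp add: lookup_sum len)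
      qed
    qed
    then have "w $ j = 0" if "j < n" for j
      using ratvs_independent_nth[OF bd, of "\<lambda>j. w $ j"] that len by simp
    then show False using w(1,2) by (auto intro: eq_vecI)
  qed
  ultimately show ?thesis by simp
qed

lemma det_uminus_mat:
  fixes A :: "'a :: comm_ring_1 mat"
  shows "det (- A) = (-1) ^ dim_col A * det A"
proof -
  have "- A = (-1) \<cdot>\<^sub>m A" by (rule eq_matI) auto
  then show ?thesis by simp
qed

section \<open>The Laplacian in vertex coordinates\<close>

definition laplacian_entry :: "'a pair_pre_digraph \<Rightarrow> 'a \<Rightarrow> 'a \<Rightarrow> int" where
  "laplacian_entry G u v = Poly_Mapping.lookup (laplacian G (frag_of v)) u"

lemma lookup_laplacian:
  assumes "finite V" "Poly_Mapping.keys D \<subseteq> V"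
  shows "Poly_Mapping.lookup (laplacian G D) u = (\<Sum>v\<in>V. laplacian_entry G u v * Poly_Mapping.lookup D v)"
proof -
  have "Poly_Mapping.lookup (laplacian G D) u = (\<Sum>v\<in>Poly_Mapping.keys D. laplacian_entry G u v * Poly_Mapping.lookup D v)"
    by (simp add: laplacian_entry_def laplacian_def frag_extend_def[of _ D] lookup_sum mult.commute)
  also have "\<dots> = (\<Sum>v\<in>V. laplacian_entry G u v * Poly_Mapping.lookup D v)"
    using assms by (intro sum.mono_neutral_left) (auto simp: in_keys_iff)
  finally show ?thesis .
qed

lemma lookup_rat_laplacian:
  assumes "finite V" "Poly_Mapping.keys x \<subseteq> V"
  shows "Poly_Mapping.lookup (rat_laplacian G x) u =
    (\<Sum>v\<in>V. of_int (laplacian_entry G u v) * Poly_Mapping.lookup x v)"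
  using assms by (simp add: rat_laplacian_superset[of V] lookup_sum laplacian_entry_def mult.commute)

lemma (in pair_graph) keys_rat_laplacian:
  assumes "Poly_Mapping.keys x \<subseteq> pverts G"
  shows "Poly_Mapping.keys (rat_laplacian G x) \<subseteq> pverts G"
proof -
  have "laplacian_entry G u v = 0" if "v \<in> pverts G" "u \<notin> pverts G" for u v
    using laplacian_in_Div0[of "frag_of v"] that
    by (auto simp: laplacian_entry_def carrier_Div carrier_Div0 in_keys_iff)
  then have "Poly_Mapping.lookup (rat_laplacian G x) u = 0" if "u \<notin> pverts G" for u
    using lookup_rat_laplacian[OF pair_finite_verts assms, of G u] that by simp
  then show ?thesis by (auto simp: in_keys_iff)
qed

section \<open>Degree-zero divisors as a hyperplane\<close>

lemma Div0_rat_keys_degree: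
  assumes fin: "finite (pverts G)" and x: "x \<in> Div0_rat G"
  shows "Poly_Mapping.keys x \<subseteq> pverts G" "(\<Sum>v\<in>pverts G. Poly_Mapping.lookup x v) = 0"
proof -
  \<comment> \<open>Support and degree are controlled for integral divisors, and clearing
    denominators carries this over to \<open>x\<close>.\<close>
  obtain n D where n: "n > 0" "D \<in> carrier (Div0 G)" "rat_scale (of_int n) x = rat_div D"
    using Div0_rat_clear_denominators[OF x] by blast
  have *: "of_int n * Poly_Mapping.lookup x v = of_int (Poly_Mapping.lookup D v)" for v
    using n(3) by (metis lookup_rat_scale lookup_rat_div)
  have D: "Poly_Mapping.keys D \<subseteq> pverts G" "div_degree D = 0"
    using n(2) by (auto simp: carrier_Div0)
  show "Poly_Mapping.keys x \<subseteq> pverts G"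
  proof
    fix v assume "v \<in> Poly_Mapping.keys x"
    then have "v \<in> Poly_Mapping.keys D" using *[of v] n(1) by (auto simp: in_keys_iff)
    then show "v \<in> pverts G" using D(1) by blast
  qed
  have "of_int n * (\<Sum>v\<in>pverts G. Poly_Mapping.lookup x v) = of_int (div_degree D)"
    by (simp add: sum_distrib_left * div_degree_superset[OF fin D(1)])
  then show "(\<Sum>v\<in>pverts G. Poly_Mapping.lookup x v) = 0"
    using n(1) D(2) by simp
qed

lemma Div0_rat_unit_diff:
  assumes "u \<in> pverts G" "v \<in> pverts G"
  shows "unit_div u - unit_div v \<in> Div0_rat G"
proof -
  have "frag_of u - frag_of v \<in> carrier (Div0 G)"
    using assms keys_diff[of "frag_of u" "frag_of v"] by (auto simp: carrier_Div0 div_degree_diff)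
  moreover have "rat_div (frag_of u - frag_of v) = unit_div u - unit_div v"
    by (rule poly_mapping_eqI) (simp add: lookup_minus lookup_single when_def)
  ultimately show ?thesis
    unfolding Div0_rat_def by (metis imageI ratvs.span_base)
qed

text \<open>A vertex has degree 1 and so lies outside the hyperplane of degree zero; every other
  vertex \<open>u\<close> is recovered as \<open>(u - v) + v\<close>. The basis obtained this way
  respects the flag given by \<open>Div0_rat\<close>.\<close>

lemma is_ordered_basis_unit_Cons:
  assumes fin: "finite (pverts G)" and v: "v \<in> pverts G" and bs: "is_ordered_basis bs (Div0_rat G)"
  shows "is_ordered_basis (unit_div v # bs) {x. Poly_Mapping.keys x \<subseteq> pverts G}"
proof -
  have sp: "ratvs.span (set bs) = Div0_rat G" using bs by (simp add: is_ordered_basis_def)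
  have nin: "unit_div v \<notin> Div0_rat G"
    using Div0_rat_keys_degree(2)[OF fin, of "unit_div v"] v fin by (auto simp: lookup_single when_def)
  have "ratvs.span (insert (unit_div v) (set bs)) = {x. Poly_Mapping.keys x \<subseteq> pverts G}" (is "?S = ?K")
  proof
    have "set bs \<subseteq> Div0_rat G" using sp ratvs.span_superset by blast
    then show "?S \<subseteq> ?K"
      using Div0_rat_keys_degree(1)[OF fin] v by (intro ratvs.span_minimal subspace_keys) auto
    have u: "unit_div u \<in> ?S" if "u \<in> pverts G" for u
    proof -
      have "unit_div u - unit_div v \<in> ?S"
        using Div0_rat_unit_diff[OF that v] sp ratvs.span_mono[of "set bs" "insert (unit_div v) (set bs)"] by blast
      moreover have "unit_div v \<in> ?S" by (simp add: ratvs.span_base)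
      ultimately have "(unit_div u - unit_div v) + unit_div v \<in> ?S" by (rule ratvs.span_add)
      then show ?thesis by simp
    qed
    show "?K \<subseteq> ?S"
    proof
      fix x assume "x \<in> ?K"
      then have x: "x = (\<Sum>v\<in>pverts G. rat_scale (Poly_Mapping.lookup x v) (unit_div v))"
        using unit_div_expansion[OF fin] by blast
      have "(\<Sum>v\<in>pverts G. rat_scale (Poly_Mapping.lookup x v) (unit_div v)) \<in> ?S"
        by (intro ratvs.span_sum ratvs.span_scale u)
      then show "x \<in> ?S" using x by simp
    qed
  qed
  moreover have "unit_div v \<notin> set bs" using nin sp ratvs.span_superset by blast
  ultimately show ?thesis
    using bs nin sp by (auto simp: is_ordered_basis_def ratvs.independent_insert)
qed

text \<open>In a basis consisting of one vertex followed by a basis of \<open>Div0_rat\<close>, the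
  operator is block triangular: the corner is its scalar on the degree quotient, and the remaining
  block is the shifted Laplacian on \<open>Div0_rat\<close>.\<close>

lemma (in pair_graph) det_laplacian_shift:
  assumes vs: "distinct vs" "set vs = pverts G" "vs \<noteq> []"
  shows "\<bar>det (list_mat vs (\<lambda>u v. of_int (laplacian_entry G u v) + (if u = v then c else 0) + 1))\<bar> =
    \<bar>c + of_nat (length vs)\<bar> * \<bar>poly (graph_char_poly G) (- c)\<bar>" (is "\<bar>det (list_mat vs ?N)\<bar> = _")
proof -
  have fin: "finite (pverts G)" by simp
  \<comment> \<open>The same choice as in \<open>endo_char_poly\<close>, so that the lower block is
    literally the matrix behind \<open>graph_char_poly\<close>.\<close>
  define bs where "bs = (SOME bs. is_ordered_basis bs (Div0_rat G))"
  have bs: "is_ordered_basis bs (Div0_rat G)"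
    unfolding bs_def using Div0_rat_ordered_basis[OF fin] by (rule someI_ex)
  define A where "A = endo_matrix bs (rat_laplacian G)"
  define m where "m = length bs"
  have A: "A \<in> carrier_mat m m" by (simp add: A_def endo_matrix_def m_def)
  have P: "graph_char_poly G = char_poly A"
    by (simp add: graph_char_poly_def endo_char_poly_def A_def bs_def)
  obtain v0 where v0_in: "v0 \<in> pverts G" using vs by (cases vs) auto
  define cs where "cs = unit_div v0 # bs"
  have cs: "is_ordered_basis cs {x. Poly_Mapping.keys x \<subseteq> set vs}"
    unfolding cs_def vs(2) by (rule is_ordered_basis_unit_Cons[OF fin v0_in bs])
  define one where "one = (\<Sum>v\<in>pverts G. unit_div v)"
  have one: "Poly_Mapping.lookup one u = (if u \<in> pverts G then 1 else 0)" for u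
    by (simp add: one_def lookup_sum lookup_single when_def)
  define dg where "dg = (\<lambda>x :: 'a \<Rightarrow>\<^sub>0 rat. \<Sum>v\<in>pverts G. Poly_Mapping.lookup x v)"
  \<comment> \<open>The all-ones matrix acts by sending \<open>x\<close> to its degree times
    \<open>one\<close>; \<open>F\<close> is thus the operator whose vertex matrix has entries
    \<open>?N\<close>.\<close>
  define F where "F = (\<lambda>x. rat_laplacian G x + rat_scale c x + rat_scale (dg x) one)"
  have keysF: "Poly_Mapping.keys (F x) \<subseteq> set vs" if "Poly_Mapping.keys x \<subseteq> set vs" for x
  proof
    fix u assume u: "u \<in> Poly_Mapping.keys (F x)"
    show "u \<in> set vs"
    proof (rule ccontr)
      assume "u \<notin> set vs"
      then have "u \<notin> Poly_Mapping.keys (rat_laplacian G x)" "u \<notin> Poly_Mapping.keys x" "u \<notin> pverts G"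
        using keys_rat_laplacian[of x] that vs(2) by blast+
      then show False using u by (simp add: F_def in_keys_iff lookup_add one)
    qed
  qed
  have FN: "Poly_Mapping.lookup (F x) u = (\<Sum>v\<in>set vs. ?N u v * Poly_Mapping.lookup x v)"
    if "Poly_Mapping.keys x \<subseteq> set vs" "u \<in> set vs" for x u
    using that
    by (simp add: F_def lookup_add lookup_rat_laplacian[of "pverts G"] one vs(2) distrib_right sum.distrib
        dg_def if_distrib[of "\<lambda>x. x * _"] cong: if_cong)
  have "det (list_mat vs ?N) = det (endo_matrix cs F)"
    by (rule det_list_mat_eq_det_endo_matrix[OF vs(1) cs keysF FN])
  also have "\<dots> = (c + of_nat (length vs)) * det (char_matrix A (- c))"
  proof -
    have csd: "distinct cs" "ratvs.independent (set cs)"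
      and csspan: "ratvs.span (set cs) = {x. Poly_Mapping.keys x \<subseteq> set vs}"
      using cs by (auto simp: is_ordered_basis_def)
    have bsi: "ratvs.independent (set bs)" and bspan: "ratvs.span (set bs) = Div0_rat G"
      using bs by (auto simp: is_ordered_basis_def)
    have v0: "unit_div v0 \<notin> set bs" using csd(1) by (simp add: cs_def)
    have ext: "ratvs.representation (set cs) x = ratvs.representation (set bs) x" if "x \<in> Div0_rat G" for x
      using that bspan by (intro ratvs.representation_extend csd(2)) (auto simp: cs_def)
    have bW: "bs ! j \<in> Div0_rat G" if "j < m" for j
      using that bspan ratvs.span_base[of "bs ! j" "set bs"] nth_mem[of j bs] by (simp add: m_def)
    have Lb: "rat_laplacian G (bs ! j) \<in> Div0_rat G" if "j < m" for j
      using bW[OF that] by (rule rat_laplacian_in_Div0_rat)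
    have Fb: "F (bs ! j) = rat_laplacian G (bs ! j) + rat_scale c (bs ! j)" if "j < m" for j
      using Div0_rat_keys_degree(2)[OF fin bW[OF that]] by (simp add: F_def dg_def)
    have FbW: "F (bs ! j) \<in> Div0_rat G" if "j < m" for j
      unfolding Fb[OF that] bspan[symmetric] using Lb[OF that] bW[OF that]
      by (intro ratvs.span_add ratvs.span_scale) (simp_all add: bspan)
    have "endo_matrix cs F \<in> carrier_mat (Suc m) (Suc m)"
      by (simp add: endo_matrix_def cs_def m_def)
    \<comment> \<open>\<open>F\<close> preserves \<open>Div0_rat\<close>, so images of its basis
      vectors have no component along the added vertex.\<close>
    moreover have "endo_matrix cs F $$ (0, Suc j) = 0" if "j < m" for j
    proof -
      have "ratvs.representation (set bs) (F (bs ! j)) (unit_div v0) = 0"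
        using ratvs.representation_ne_zero[of "set bs" "F (bs ! j)"] v0 by blast
      then show ?thesis
        using that by (simp add: endo_matrix_def cs_def m_def ext[OF FbW[OF that], unfolded cs_def, simplified])
    qed
    ultimately have "det (endo_matrix cs F) = endo_matrix cs F $$ (0, 0) *
        det (mat m m (\<lambda>(i, j). endo_matrix cs F $$ (Suc i, Suc j)))"
      by (rule det_first_row_zero)
    also have "mat m m (\<lambda>(i, j). endo_matrix cs F $$ (Suc i, Suc j)) = char_matrix A (- c)"
    proof (rule eq_matI)
      fix i j assume "i < dim_row (char_matrix A (- c))" "j < dim_col (char_matrix A (- c))"
      then have ij: "i < m" "j < m" using A by (auto simp: char_matrix_def)
      have "endo_matrix cs F $$ (Suc i, Suc j) = ratvs.representation (set cs) (F (bs ! j)) (bs ! i)"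
        using ij by (simp add: endo_matrix_def cs_def m_def)
      also have "\<dots> = ratvs.representation (set bs) (F (bs ! j)) (bs ! i)"
        by (simp add: ext[OF FbW[OF ij(2)]])
      also have "\<dots> = ratvs.representation (set bs) (rat_laplacian G (bs ! j)) (bs ! i)
          + c * ratvs.representation (set bs) (bs ! j) (bs ! i)"
        unfolding Fb[OF ij(2)] using Lb[OF ij(2)] bW[OF ij(2)] ratvs.span_scale[of "bs ! j" "set bs" c]
        by (simp add: ratvs.representation_add[OF bsi] ratvs.representation_scale[OF bsi] bspan)
      also have "ratvs.representation (set bs) (bs ! j) (bs ! i) = (if i = j then 1 else 0)"
        using ij csd(1) by (simp add: ratvs.representation_basis[OF bsi] cs_def m_def nth_eq_iff_index_eq)
      finally show "mat m m (\<lambda>(i, j). endo_matrix cs F $$ (Suc i, Suc j)) $$ (i, j) = char_matrix A (- c) $$ (i, j)"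
        using ij by (simp add: char_matrix_def A_def endo_matrix_def m_def)
    qed (use A in \<open>auto simp: char_matrix_def\<close>)
    \<comment> \<open>The members of \<open>bs\<close> have degree zero and \<open>v0\<close> has
      degree 1, so the coefficient of \<open>v0\<close> in its image is the degree of that image: 0
      from the Laplacian, \<open>c\<close> from the shift, and the number of vertices from
      \<open>one\<close>.\<close>
    also have "endo_matrix cs F $$ (0, 0) = c + of_nat (length vs)"
    proof -
      let ?x = "F (unit_div v0)" and ?r = "ratvs.representation (set cs) (F (unit_div v0))"
      have x: "?x = (\<Sum>b\<in>set cs. rat_scale (?r b) b)"
        using keysF[of "unit_div v0"] v0_in csd(2) vs(2)
        by (intro ratvs.sum_representation_eq[symmetric]) (simp_all add: csspan)
      have lin: "dg (\<Sum>b\<in>B. rat_scale (f b) b) = (\<Sum>b\<in>B. f b * dg b)" for B f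
        unfolding dg_def by (simp add: lookup_sum sum_distrib_left) (rule sum.swap)
      have dg1: "dg (unit_div v0) = 1"
        using v0_in fin by (simp add: dg_def lookup_single when_def)
      have "dg ?x = (\<Sum>b\<in>set cs. ?r b * dg b)"
        by (subst x) (rule lin)
      also have "\<dots> = (\<Sum>b\<in>{unit_div v0}. ?r b * dg b)"
      proof (rule sum.mono_neutral_right)
        have "dg b = 0" if "b \<in> set bs" for b
          using Div0_rat_keys_degree(2)[OF fin, of b] ratvs.span_base[OF that] by (simp add: bspan dg_def)
        then show "\<forall>b\<in>set cs - {unit_div v0}. ?r b * dg b = 0" by (auto simp: cs_def)
      qed (auto simp: cs_def)
      finally have "?r (unit_div v0) = dg ?x"
        by (simp add: dg1)
      moreover have "dg ?x = c + of_nat (length vs)"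
      proof -
        have "laplacian G (frag_of v0) \<in> carrier (Div0 G)"
          using v0_in by (intro laplacian_in_Div0) (simp add: carrier_Div)
        then have "rat_div (laplacian G (frag_of v0)) \<in> Div0_rat G"
          unfolding Div0_rat_def by (intro ratvs.span_base imageI)
        moreover have "rat_div (frag_of v0) = unit_div v0"
          by (rule poly_mapping_eqI) (simp add: lookup_single when_def)
        ultimately have "rat_laplacian G (unit_div v0) \<in> Div0_rat G"
          using rat_laplacian_rat_div[of G "frag_of v0"] by simp
        then have "dg (rat_laplacian G (unit_div v0)) = 0"
          unfolding dg_def by (rule Div0_rat_keys_degree(2)[OF fin])
        moreover have "dg (x + y) = dg x + dg y" "dg (rat_scale a x) = a * dg x" for x y a
          by (simp_all add: dg_def lookup_add sum.distrib sum_distrib_left)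
        moreover have "dg one = of_nat (length vs)"
          using vs distinct_card[of vs] by (simp add: dg_def one)
        ultimately show ?thesis using dg1 by (simp add: F_def)
      qed
      ultimately show ?thesis by (simp add: endo_matrix_def cs_def)
    qed
    finally show ?thesis .
  qed
  finally show ?thesis
    \<comment> \<open>The characteristic polynomial at \<open>- c\<close> is the determinant of the
      negated block; the resulting power of -1 disappears in the absolute value.\<close>
    using A by (simp add: P char_poly_matrix[OF A] det_uminus_mat abs_mult power_abs)
qed

section \<open>Order of the Picard group\<close>

context pair_graph
begin

section \<open>Symmetry, zero sums and positivity\<close>

lemma laplacian_entry_eq:
  "laplacian_entry G u v =
    (if u = v then int (card {w. (v, w) \<in> parcs G}) else 0) - (if (u, v) \<in> parcs G then 1 else 0)"
proof -
  have "out_arcs (with_proj G) v = Pair v ` {w. (v, w) \<in> parcs G}"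
    by (auto simp: out_arcs_def)
  then have deg: "out_degree (with_proj G) v = card {w. (v, w) \<in> parcs G}"
    by (simp add: out_degree_def card_image inj_on_def)
  have "finite {w. (w, v) \<in> parcs G}"
    by (rule finite_subset[OF _ pair_finite_verts]) (auto dest: in_arcsD1)
  then have "(\<Sum>w | (w, v) \<in> parcs G. if u = w then 1 else 0) = (if (u, v) \<in> parcs G then 1 else 0 :: int)"
    by simp
  then show ?thesis
    by (simp add: laplacian_entry_def laplacian_def deg lookup_minus lookup_sum)
qed

lemma parcs_sym: "(u, v) \<in> parcs G \<longleftrightarrow> (v, u) \<in> parcs G"
  using pair_sym_arcs by (auto simp: symmetric_def dest: symD)

lemma laplacian_entry_sym: "laplacian_entry G u v = laplacian_entry G v u"
  using parcs_sym[of u v] by (auto simp: laplacian_entry_eq)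

lemma laplacian_entry_col_sum:
  assumes "v \<in> pverts G"
  shows "(\<Sum>u\<in>pverts G. laplacian_entry G u v) = 0"
  using laplacian_in_Div0[of "frag_of v"] assms div_degree_superset[OF pair_finite_verts, of "laplacian G (frag_of v)"]
  by (simp add: carrier_Div carrier_Div0 laplacian_entry_def)

lemma laplacian_entry_row_sum:
  assumes "v \<in> pverts G"
  shows "(\<Sum>u\<in>pverts G. laplacian_entry G v u) = 0"
  using laplacian_entry_col_sum[OF assms] by (simp add: laplacian_entry_sym[of v])

text \<open>Expanding the squares leaves the mixed terms, because the pure squares meet vanishing
  row or column sums. The factor 2 reflects that each edge contributes two arcs.\<close>

lemma laplacian_quadratic_form:
  fixes g :: "'a \<Rightarrow> int"
  shows "2 * (\<Sum>u\<in>pverts G. \<Sum>v\<in>pverts G. laplacian_entry G u v * g u * g v) =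
    (\<Sum>u\<in>pverts G. \<Sum>v\<in>pverts G. if (u, v) \<in> parcs G then (g u - g v)\<^sup>2 else 0)"
proof -
  let ?L = "laplacian_entry G" and ?V = "pverts G"
  have "(\<Sum>u\<in>?V. \<Sum>v\<in>?V. ?L u v * (g u)\<^sup>2) = (\<Sum>u\<in>?V. (\<Sum>v\<in>?V. ?L u v) * (g u)\<^sup>2)"
    by (simp add: sum_distrib_right)
  then have 1: "(\<Sum>u\<in>?V. \<Sum>v\<in>?V. ?L u v * (g u)\<^sup>2) = 0"
    by (simp add: laplacian_entry_row_sum)
  have "(\<Sum>u\<in>?V. \<Sum>v\<in>?V. ?L u v * (g v)\<^sup>2) = (\<Sum>v\<in>?V. (\<Sum>u\<in>?V. ?L u v) * (g v)\<^sup>2)"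
    unfolding sum_distrib_right by (rule sum.swap)
  then have 2: "(\<Sum>u\<in>?V. \<Sum>v\<in>?V. ?L u v * (g v)\<^sup>2) = 0"
    by (simp add: laplacian_entry_col_sum)
  have e: "(if (u, v) \<in> parcs G then (g u - g v)\<^sup>2 else 0) =
      2 * (?L u v * g u * g v) - ?L u v * (g u)\<^sup>2 - ?L u v * (g v)\<^sup>2" for u v
  proof -
    \<comment> \<open>Off the diagonal the entry is minus the adjacency; on the diagonal the square
      is zero.\<close>
    have "(if (u, v) \<in> parcs G then (g u - g v)\<^sup>2 else 0) = - ?L u v * (g u - g v)\<^sup>2"
      by (auto simp: laplacian_entry_eq)
    then show ?thesis by (simp add: power2_eq_square algebra_simps)
  qed
  show ?thesis
    unfolding e by (simp add: sum_subtractf 1 2 flip: sum_distrib_left)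
qed

text \<open>On a kernel vector, the form of \<open>L + J\<close> is a sum of squares over edges plus
  the square of the total. Both must vanish: the vector is constant by connectedness and has sum
  zero, hence is zero. Connectedness enters as constancy of integer functions that agree along arcs,
  which is easy to verify for joins.\<close>

lemma det_laplacian_plus_one_nonzero:
  assumes vs: "distinct vs" "set vs = pverts G"
    and conn: "\<And>(g :: 'a \<Rightarrow> int) u v. (\<And>x y. (x, y) \<in> parcs G \<Longrightarrow> g x = g y) \<Longrightarrow>
      u \<in> pverts G \<Longrightarrow> v \<in> pverts G \<Longrightarrow> g u = g v"
  shows "det (list_mat vs (\<lambda>u v. laplacian_entry G u v + 1)) \<noteq> 0"
proof
  let ?L = "laplacian_entry G" and ?V = "pverts G" and ?n = "length vs"
  let ?N = "list_mat vs (\<lambda>u v. ?L u v + 1)"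
  assume "det ?N = 0"
  then obtain w where w: "w \<in> carrier_vec ?n" "w \<noteq> 0\<^sub>v ?n" "?N *\<^sub>v w = 0\<^sub>v ?n"
    using det_0_iff_vec_prod_zero[of ?N ?n] by auto
  \<comment> \<open>The kernel vector, regarded as a function on vertices.\<close>
  define g where "g = (\<lambda>u. w $ inv_into {0..<?n} ((!) vs) u)"
  have inj: "inj_on ((!) vs) {0..<?n}"
    using vs(1) by (auto simp: inj_on_def nth_eq_iff_index_eq)
  have g: "g (vs ! i) = w $ i" if "i < ?n" for i
    unfolding g_def using inj that by (simp add: inv_into_f_f)
  have ker: "(\<Sum>v\<in>?V. (?L u v + 1) * g v) = 0" if u: "u \<in> ?V" for u
  proof -
    obtain i where i: "i < ?n" "u = vs ! i" using u vs(2) by (metis in_set_conv_nth)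
    have "(?N *\<^sub>v w) $ i = (\<Sum>k = 0..<?n. (?L u (vs ! k) + 1) * g (vs ! k))"
    proof -
      have "(?N *\<^sub>v w) $ i = (\<Sum>k = 0..<?n. ?N $$ (i, k) * w $ k)"
        using i(1) carrier_vecD[OF w(1)] by (simp add: scalar_prod_def)
      then show ?thesis using i(1) by (simp add: g i(2))
    qed
    also have "\<dots> = (\<Sum>v\<in>?V. (?L u v + 1) * g v)"
      using sum_nth_distinct[OF vs(1), of "\<lambda>v. (?L u v + 1) * g v"] by (simp add: vs(2))
    finally show ?thesis using w(3) i by simp
  qed
  have "(\<Sum>u\<in>?V. \<Sum>v\<in>?V. ?L u v * g u * g v) + (\<Sum>u\<in>?V. g u)\<^sup>2 = (\<Sum>u\<in>?V. g u * (\<Sum>v\<in>?V. (?L u v + 1) * g v))"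
    by (simp add: sum_distrib_left sum_product power2_eq_square sum.distrib algebra_simps)
  also have "\<dots> = 0" by (simp add: ker)
  finally have z: "(\<Sum>u\<in>?V. \<Sum>v\<in>?V. if (u, v) \<in> parcs G then (g u - g v)\<^sup>2 else 0) + 2 * (\<Sum>u\<in>?V. g u)\<^sup>2 = 0"
    by (simp flip: laplacian_quadratic_form)
  have nonneg: "(\<Sum>v\<in>?V. if (u, v) \<in> parcs G then (g u - g v)\<^sup>2 else 0) \<ge> 0" for u
    by (intro sum_nonneg) auto
  have q: "(\<Sum>u\<in>?V. \<Sum>v\<in>?V. if (u, v) \<in> parcs G then (g u - g v)\<^sup>2 else 0) \<ge> 0"
    by (intro sum_nonneg[of ?V] nonneg)
  have q0: "(\<Sum>u\<in>?V. \<Sum>v\<in>?V. if (u, v) \<in> parcs G then (g u - g v)\<^sup>2 else 0) = 0"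
    and s0: "(\<Sum>u\<in>?V. g u) = 0"
    using z q by (simp_all add: add_nonneg_eq_0_iff)
  have "g x = g y" if "(x, y) \<in> parcs G" for x y
  proof -
    have xy: "x \<in> ?V" "y \<in> ?V" using that by (auto dest: in_arcsD1 in_arcsD2)
    have "(\<Sum>v\<in>?V. if (x, v) \<in> parcs G then (g x - g v)\<^sup>2 else 0) = 0"
      using q0 nonneg xy by (simp add: sum_nonneg_eq_0_iff)
    then have "(if (x, y) \<in> parcs G then (g x - g y)\<^sup>2 else 0) = 0"
      using xy by (subst (asm) sum_nonneg_eq_0_iff) auto
    then show ?thesis using that by simp
  qed
  from conn[of g, OF this] have c: "g u = g v" if "u \<in> ?V" "v \<in> ?V" for u v using that by blast
  have "w $ i = 0" if "i < ?n" for i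
  proof -
    have vi: "vs ! i \<in> ?V" using that vs(2) nth_mem by blast
    have "(\<Sum>u\<in>?V. g u) = (\<Sum>u\<in>?V. g (vs ! i))"
      by (rule sum.cong[OF refl]) (rule c[OF _ vi])
    then have "int (card ?V) * g (vs ! i) = 0" using s0 by simp
    then show ?thesis using vi g[OF that] by auto
  qed
  then show False using w(1,2) by (auto intro: eq_vecI)
qed

section \<open>Cosets of the Laplacian image\<close>

lemma laplacian_add: "laplacian G (D + E) = laplacian G D + laplacian G E"
  by (simp add: laplacian_def frag_extend_add)

lemma laplacian_diff: "laplacian G (D - E) = laplacian G D - laplacian G E"
  by (simp add: laplacian_def frag_extend_diff)

lemma carrier_Pic0:
  "carrier (Pic0 G) = (\<lambda>D. (\<lambda>Z. laplacian G Z + D) ` carrier (Div G)) ` carrier (Div0 G)"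
proof -
  have "D \<otimes>\<^bsub>Div0 G\<^esub> E = D + E" for D E
    by (simp add: Div0_def Div_def)
  then show ?thesis
    by (auto simp: Pic0_def FactGroup_def RCOSETS_def r_coset_def)
qed

lemma Pic0_coset_eq_iff:
  "(\<lambda>Z. laplacian G Z + D) ` carrier (Div G) = (\<lambda>Z. laplacian G Z + E) ` carrier (Div G) \<longleftrightarrow>
    (\<exists>Z\<in>carrier (Div G). D = E + laplacian G Z)" (is "?C D = ?C E \<longleftrightarrow> ?R")
proof
  assume eq: "?C D = ?C E"
  have "D = laplacian G 0 + D" by (simp add: laplacian_def)
  then have "D \<in> ?C D" by (rule image_eqI) (simp add: carrier_Div)
  then obtain Z where "Z \<in> carrier (Div G)" "D = laplacian G Z + E" unfolding eq by blast
  then show ?R by (metis add.commute)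
next
  assume ?R
  then obtain Z where Z: "Z \<in> carrier (Div G)" "D = E + laplacian G Z" by blast
  show "?C D = ?C E"
  proof (intro subset_antisym image_subsetI)
    fix Y assume Y: "Y \<in> carrier (Div G)"
    show "laplacian G Y + D \<in> ?C E"
      by (rule image_eqI[of _ _ "Y + Z"])
        (use Y Z keys_add[of Y Z] in \<open>auto simp: carrier_Div laplacian_add\<close>)
    show "laplacian G Y + E \<in> ?C D"
      by (rule image_eqI[of _ _ "Y - Z"])
        (use Y Z keys_diff[of Y Z] in \<open>auto simp: carrier_Div laplacian_diff\<close>)
  qed
qed

text \<open>The coordinates at the vertices other than \<open>v0\<close> identify \<open>Div\<^sup>0\<close> with \<open>\<int>\<^sup>m\<close>
  and the image of the Laplacian with the lattice generated by the reduced Laplacian.\<close>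

lemma card_Pic0:
  assumes dist: "distinct (v0 # ws)" and V: "set (v0 # ws) = pverts G"
    and nz: "det (list_mat ws (laplacian_entry G)) \<noteq> 0"
  shows "finite (carrier (Pic0 G))"
    "int (card (carrier (Pic0 G))) = \<bar>det (list_mat ws (laplacian_entry G))\<bar>"
proof -
  define m where "m = length ws"
  define M where "M = list_mat ws (laplacian_entry G)"
  have M: "M \<in> carrier_mat m m" by (simp add: M_def m_def)
  have wsV: "ws ! i \<in> pverts G" if "i < m" for i
    using that unfolding V[symmetric] m_def by simp
  define crd where "crd = (\<lambda>D. vec m (\<lambda>i. Poly_Mapping.lookup D (ws ! i)) :: int vec)"
  define lft where "lft = (\<lambda>t :: int vec. \<Sum>i = 0..<m. frag_cmul (t $ i) (frag_of (ws ! i)))"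
  \<comment> \<open>\<open>lft\<close> puts 0 at \<open>v0\<close>; \<open>dv\<close> puts there
    minus the sum of the other coefficients, which makes the degree zero and inverts
    \<open>crd\<close> on \<open>Div0\<close>.\<close>
  define dv where "dv = (\<lambda>t :: int vec. lft t - frag_cmul (\<Sum>i = 0..<m. t $ i) (frag_of v0))"
  have lft_ws: "Poly_Mapping.lookup (lft t) (ws ! i) = t $ i" if "i < m" for t i
  proof -
    have "Poly_Mapping.lookup (lft t) (ws ! i) = (\<Sum>k = 0..<m. if k = i then t $ k else 0)"
      unfolding lft_def lookup_sum
      by (rule sum.cong) (use that dist in \<open>auto simp: m_def nth_eq_iff_index_eq\<close>)
    then show ?thesis using that by simp
  qed
  have lft_v0: "Poly_Mapping.lookup (lft t) v0 = 0" for t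
    unfolding lft_def lookup_sum using dist nth_mem[of _ ws] by (intro sum.neutral) (auto simp: m_def)
  have lft_Div: "lft t \<in> carrier (Div G)" for t
  proof -
    have "Poly_Mapping.keys (frag_cmul (t $ i) (frag_of (ws ! i))) \<subseteq> pverts G" if "i < m" for i
      using keys_cmul[of "t $ i" "frag_of (ws ! i)"] wsV[OF that] by auto
    then have "(\<Union>i\<in>{0..<m}. Poly_Mapping.keys (frag_cmul (t $ i) (frag_of (ws ! i)))) \<subseteq> pverts G"
      by (intro UN_least) simp
    then show ?thesis
      unfolding lft_def carrier_Div mem_Collect_eq by (rule order_trans[OF keys_sum])
  qed
  have dv_Div0: "dv t \<in> carrier (Div0 G)" for t
  proof -
    have "Poly_Mapping.keys (dv t) \<subseteq> pverts G"
      unfolding dv_def using lft_Div[of t] V keys_cmul[of _ "frag_of v0"]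
      by (intro order_trans[OF keys_diff] Un_least) (auto simp: carrier_Div)
    moreover have "div_degree (dv t) = 0"
      by (simp add: dv_def lft_def div_degree_diff div_degree_sum div_degree_cmul)
    ultimately show ?thesis by (simp add: carrier_Div0)
  qed
  have crd_dv: "crd (dv t) = t" if "t \<in> carrier_vec m" for t
  proof (rule eq_vecI)
    fix i assume "i < dim_vec t"
    then have i: "i < m" using that by simp
    have "ws ! i \<noteq> v0" using i dist nth_mem[of i ws] by (auto simp: m_def)
    then show "crd (dv t) $ i = t $ i" using i by (simp add: crd_def dv_def lookup_minus lft_ws)
  qed (use that in \<open>simp add: crd_def\<close>)
  have crd_inj: "D = E" if DE: "D \<in> carrier (Div0 G)" "E \<in> carrier (Div0 G)" and eq: "crd D = crd E" for D E
  proof -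
    have ws: "Poly_Mapping.lookup D w = Poly_Mapping.lookup E w" if w: "w \<in> set ws" for w
    proof -
      obtain i where "i < m" "w = ws ! i" using w by (auto simp: in_set_conv_nth m_def)
      then show ?thesis using arg_cong[OF eq, of "\<lambda>x. x $ i"] by (simp add: crd_def)
    qed
    have sp: "(\<Sum>v\<in>pverts G. Poly_Mapping.lookup F v) = Poly_Mapping.lookup F v0 + (\<Sum>v\<in>set ws. Poly_Mapping.lookup F v)" for F :: "'a \<Rightarrow>\<^sub>0 int"
      using dist by (simp flip: V)
    have "Poly_Mapping.lookup D v0 + (\<Sum>v\<in>set ws. Poly_Mapping.lookup D v) = 0"
      "Poly_Mapping.lookup E v0 + (\<Sum>v\<in>set ws. Poly_Mapping.lookup E v) = 0"
      using DE div_degree_superset[OF pair_finite_verts, of D] div_degree_superset[OF pair_finite_verts, of E]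
      by (simp_all add: carrier_Div0 sp)
    then have v0: "Poly_Mapping.lookup D v0 = Poly_Mapping.lookup E v0" using ws by simp
    show ?thesis
    proof (rule poly_mapping_eqI)
      fix u
      show "Poly_Mapping.lookup D u = Poly_Mapping.lookup E u"
      proof (cases "u \<in> pverts G")
        case True
        then have "u = v0 \<or> u \<in> set ws" by (simp flip: V)
        then show ?thesis using ws v0 by blast
      next
        case False
        then have "u \<notin> Poly_Mapping.keys D" "u \<notin> Poly_Mapping.keys E"
          using DE by (auto simp: carrier_Div0)
        then show ?thesis by (simp add: in_keys_iff)
      qed
    qed
  qed
  have crd_add: "crd (D + E) = crd D + crd E" for D E
    by (rule eq_vecI) (simp_all add: crd_def lookup_add)
  \<comment> \<open>Constant divisors lie in the kernel because the row sums vanish. Subtracting the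
    value at \<open>v0\<close> everywhere thus keeps the image and removes the column of
    \<open>v0\<close>.\<close>
  have crd_lap: "crd (laplacian G Z) =
      M *\<^sub>v vec m (\<lambda>k. Poly_Mapping.lookup Z (ws ! k) - Poly_Mapping.lookup Z v0)" (is "_ = M *\<^sub>v ?z")
    if Z: "Z \<in> carrier (Div G)" for Z
  proof (rule eq_vecI)
    fix i assume "i < dim_vec (M *\<^sub>v ?z)"
    then have i: "i < m" using M by simp
    let ?u = "ws ! i" and ?c = "Poly_Mapping.lookup Z v0"
    have "crd (laplacian G Z) $ i = (\<Sum>v\<in>pverts G. laplacian_entry G ?u v * Poly_Mapping.lookup Z v)"
      using i Z by (simp add: crd_def lookup_laplacian[OF pair_finite_verts] carrier_Div)
    also have "\<dots> = (\<Sum>v\<in>pverts G. laplacian_entry G ?u v * (Poly_Mapping.lookup Z v - ?c))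
        + (\<Sum>v\<in>pverts G. laplacian_entry G ?u v) * ?c"
      by (simp add: right_diff_distrib sum_subtractf sum_distrib_right)
    also have "\<dots> = (\<Sum>v\<in>pverts G. laplacian_entry G ?u v * (Poly_Mapping.lookup Z v - ?c))"
      using laplacian_entry_row_sum[OF wsV[OF i]] by simp
    also have "\<dots> = (\<Sum>v\<in>set ws. laplacian_entry G ?u v * (Poly_Mapping.lookup Z v - ?c))"
      using dist by (simp flip: V)
    also have "\<dots> = (\<Sum>k = 0..<m. laplacian_entry G ?u (ws ! k) * (Poly_Mapping.lookup Z (ws ! k) - ?c))"
      using sum_nth_distinct[of ws "\<lambda>v. laplacian_entry G ?u v * (Poly_Mapping.lookup Z v - ?c)"] dist
      by (simp add: m_def)
    also have "\<dots> = (M *\<^sub>v ?z) $ i"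
      using i by (simp add: M_def m_def scalar_prod_def)
    finally show "crd (laplacian G Z) $ i = (M *\<^sub>v ?z) $ i" .
  qed (use M in \<open>simp add: crd_def\<close>)
  have crd_lft: "crd (laplacian G (lft z)) = M *\<^sub>v z" if "z \<in> carrier_vec m" for z
  proof -
    have "vec m (\<lambda>k. Poly_Mapping.lookup (lft z) (ws ! k) - Poly_Mapping.lookup (lft z) v0) = z"
      using that by (intro eq_vecI) (auto simp: lft_ws lft_v0)
    then show ?thesis by (simp add: crd_lap[OF lft_Div])
  qed
  obtain T where T: "is_transversal M T" "finite T" "int (card T) = \<bar>det M\<bar>"
    using int_mat_transversal[OF M] nz by (auto simp: M_def)
  have Tc: "T \<subseteq> carrier_vec m"
    and Tx: "\<And>x. x \<in> carrier_vec m \<Longrightarrow> \<exists>!t. t \<in> T \<and> (\<exists>z\<in>carrier_vec m. x = t + M *\<^sub>v z)"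
    using T(1) M by (auto simp: is_transversal_def)
  let ?C = "\<lambda>D. (\<lambda>Z. laplacian G Z + D) ` carrier (Div G)"
  \<comment> \<open>Representatives of the cokernel of the reduced Laplacian lift along
    \<open>dv\<close> to representatives of the classes in \<open>Pic0 G\<close>.\<close>
  have im: "carrier (Pic0 G) = (\<lambda>t. ?C (dv t)) ` T"
    unfolding carrier_Pic0
  proof (intro subset_antisym image_subsetI)
    fix D assume D: "D \<in> carrier (Div0 G)"
    have "crd D \<in> carrier_vec m" by (simp add: crd_def)
    then obtain t z where t: "t \<in> T" "z \<in> carrier_vec m" "crd D = t + M *\<^sub>v z" using Tx by blast
    have "dv t + laplacian G (lft z) \<in> carrier (Div0 G)"
      using dv_Div0[of t] laplacian_in_Div0[OF lft_Div[of z]] keys_add[of "dv t" "laplacian G (lft z)"]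
      by (auto simp: carrier_Div0 div_degree_add)
    moreover have "crd D = crd (dv t + laplacian G (lft z))"
      using t Tc by (simp add: crd_add crd_lft crd_dv subset_eq)
    ultimately have "D = dv t + laplacian G (lft z)" using crd_inj[OF D] by blast
    then have "?C D = ?C (dv t)" using lft_Div unfolding Pic0_coset_eq_iff by blast
    then show "?C D \<in> (\<lambda>t. ?C (dv t)) ` T" using t(1) by blast
  next
    fix t assume "t \<in> T"
    show "?C (dv t) \<in> ?C ` carrier (Div0 G)" by (rule imageI[OF dv_Div0])
  qed
  have inj: "inj_on (\<lambda>t. ?C (dv t)) T"
  proof (rule inj_onI)
    fix t t' assume tt: "t \<in> T" "t' \<in> T" and "?C (dv t) = ?C (dv t')"
    then obtain Z where Z: "Z \<in> carrier (Div G)" "dv t = dv t' + laplacian G Z"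
      unfolding Pic0_coset_eq_iff by blast
    have c: "t \<in> carrier_vec m" "t' \<in> carrier_vec m" using tt Tc by auto
    have "t = crd (dv t)" using c by (simp add: crd_dv)
    also have "\<dots> = t' + crd (laplacian G Z)" using c by (simp add: Z(2) crd_add crd_dv)
    finally have 1: "\<exists>z\<in>carrier_vec m. t = t' + M *\<^sub>v z"
      unfolding crd_lap[OF Z(1)] by (intro bexI) auto
    have "M *\<^sub>v 0\<^sub>v m = 0\<^sub>v m"
      using M by (intro eq_vecI) auto
    then have 2: "\<exists>z\<in>carrier_vec m. t = t + M *\<^sub>v z"
      using c by (intro bexI[of _ "0\<^sub>v m"]) auto
    show "t = t'" using Tx[OF c(1)] 1 2 tt by blast
  qed
  show "finite (carrier (Pic0 G))" unfolding im using T(2) by simp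
  show "int (card (carrier (Pic0 G))) = \<bar>det (list_mat ws (laplacian_entry G))\<bar>"
    unfolding im card_image[OF inj] using T(3) by (simp add: M_def)
qed

text \<open>Passing from the reduced Laplacian to \<open>L + J\<close> removes the choice of a
  vertex and makes the matrix of a join block diagonal. The factor from
  \<open>det_list_mat_plus_one\<close> stays on the left to remain within the integers.\<close>

lemma card_Pic0_det_plus_one:
  assumes vs: "distinct vs" "set vs = pverts G" "vs \<noteq> []"
    and conn: "\<And>(g :: 'a \<Rightarrow> int) u v. (\<And>x y. (x, y) \<in> parcs G \<Longrightarrow> g x = g y) \<Longrightarrow>
      u \<in> pverts G \<Longrightarrow> v \<in> pverts G \<Longrightarrow> g u = g v"
  shows "finite (carrier (Pic0 G))"
    "int (length vs) ^ 2 * int (card (carrier (Pic0 G))) =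
      \<bar>det (list_mat vs (\<lambda>u v. laplacian_entry G u v + 1))\<bar>"
proof -
  obtain v0 ws where vw: "vs = v0 # ws" using vs(3) by (cases vs) auto
  have det: "det (list_mat vs (\<lambda>u v. laplacian_entry G u v + 1)) =
      int (length vs) ^ 2 * det (list_mat ws (laplacian_entry G))"
    unfolding vw by (rule det_list_mat_plus_one)
      (use vs laplacian_entry_row_sum laplacian_entry_col_sum in \<open>simp_all only: vw\<close>)
  then have nz: "det (list_mat ws (laplacian_entry G)) \<noteq> 0"
    using det_laplacian_plus_one_nonzero[OF vs(1,2) conn] by auto
  show "finite (carrier (Pic0 G))"
    using card_Pic0(1)[of v0 ws, OF _ _ nz] vs vw by simp
  show "int (length vs) ^ 2 * int (card (carrier (Pic0 G))) =
      \<bar>det (list_mat vs (\<lambda>u v. laplacian_entry G u v + 1))\<bar>"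
    using card_Pic0(2)[of v0 ws, OF _ _ nz] vs vw det by (simp add: abs_mult)
qed

end

section \<open>Joins\<close>

text \<open>Connectedness is reachability in the symmetric closure, and the function is unchanged
  along each step of a path in either direction.\<close>

lemma (in pair_graph) connected_imp_constant:
  assumes "Digraph_Component.connected (with_proj G)"
    and arcs: "\<And>x y. (x, y) \<in> parcs G \<Longrightarrow> g x = g y"
    and uv: "u \<in> pverts G" "v \<in> pverts G"
  shows "g u = g v"
proof -
  let ?S = "mk_symmetric (with_proj G)"
  have "(u, v) \<in> rtrancl_on (pverts ?S) (parcs ?S)"
    using assms(1) uv by (auto simp: Digraph_Component.connected_def strongly_connected_def reachable_def)
  then have "(u, v) \<in> (parcs ?S)\<^sup>*" by (rule rtrancl_on_rtranclI)
  then show ?thesis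
  proof induction
    case (step y z)
    then show ?case using arcs by (auto simp: parcs_mk_symmetric)
  qed simp
qed

lemma graph_join_simps:
  "pverts (graph_join l \<Gamma>) = (SIGMA i:{1..l}. pverts (\<Gamma> i))"
  "((i, u), (j, v)) \<in> parcs (graph_join l \<Gamma>) \<longleftrightarrow> i \<in> {1..l} \<and> j \<in> {1..l} \<and>
    (if i = j then (u, v) \<in> parcs (\<Gamma> i) else u \<in> pverts (\<Gamma> i) \<and> v \<in> pverts (\<Gamma> j))"
  by (auto simp: graph_join_def)

lemma pair_graph_graph_join:
  assumes "\<And>i. i \<in> {1..l} \<Longrightarrow> pair_graph (\<Gamma> i)"
  shows "pair_graph (graph_join l \<Gamma>)"
proof -
  let ?J = "graph_join l \<Gamma>"
  have V: "pair_fin_digraph (\<Gamma> i)" "pair_wf_digraph (\<Gamma> i)" "pair_sym_digraph (\<Gamma> i)" "pair_loopfree_digraph (\<Gamma> i)"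
    if "i \<in> {1..l}" for i
    using assms[OF that] by (simp_all add: pair_graph_def pair_digraph_def pair_pseudo_graph_def pair_fin_digraph_def)
  have arcs: "parcs ?J \<subseteq> pverts ?J \<times> pverts ?J"
  proof (clarify, unfold graph_join_simps)
    fix i u j v
    assume a: "i \<in> {1..l} \<and> j \<in> {1..l} \<and> (if i = j then (u, v) \<in> parcs (\<Gamma> i) else u \<in> pverts (\<Gamma> i) \<and> v \<in> pverts (\<Gamma> j))"
    show "(i, u) \<in> (SIGMA i:{1..l}. pverts (\<Gamma> i)) \<and> (j, v) \<in> (SIGMA i:{1..l}. pverts (\<Gamma> i))"
      using a V(2)[of i] by (auto split: if_splits dest: pair_wf_digraph.in_arcsD1 pair_wf_digraph.in_arcsD2)
  qed
  have fin: "finite (pverts ?J)"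
    using V(1) by (auto simp: graph_join_simps intro!: finite_SigmaI pair_fin_digraph.pair_finite_verts)
  have sym: "sym (parcs ?J)"
  proof (rule symI)
    fix p q assume "(p, q) \<in> parcs ?J"
    then show "(q, p) \<in> parcs ?J"
      using pair_sym_digraph.pair_sym_arcs[OF V(3)]
      by (cases p; cases q) (auto simp: graph_join_simps symmetric_def split: if_splits dest: symD)
  qed
  show ?thesis
  proof unfold_locales
    fix e assume "e \<in> parcs ?J"
    then show "fst e \<noteq> snd e"
      using pair_loopfree_digraph.pair_no_loops[OF V(4)]
      by (cases e; cases "fst e"; cases "snd e") (fastforce simp: graph_join_simps split: if_splits)
  qed (use arcs fin sym finite_subset[OF arcs] in \<open>auto simp: symmetric_def\<close>)
qed

text \<open>Vertices in different parts are adjacent, so their entry -1 cancels against the added 1.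
  Within a part, only the diagonal changes: each vertex gains all vertices outside its part as
  neighbours.\<close>

lemma laplacian_entry_graph_join:
  assumes G: "\<And>i. i \<in> {1..l} \<Longrightarrow> pair_graph (\<Gamma> i)"
    and ij: "i \<in> {1..l}" "j \<in> {1..l}" and uv: "u \<in> pverts (\<Gamma> i)" "v \<in> pverts (\<Gamma> j)"
  defines "K \<equiv> \<Sum>i=1..l. card (pverts (\<Gamma> i))"
  shows "laplacian_entry (graph_join l \<Gamma>) (i, u) (j, v) + 1 =
    (if i = j then laplacian_entry (\<Gamma> i) u v + (if u = v then int K - int (card (pverts (\<Gamma> i))) else 0) + 1 else 0)"
proof -
  interpret J: pair_graph "graph_join l \<Gamma>" by (rule pair_graph_graph_join[OF G])
  interpret Gi: pair_graph "\<Gamma> i" by (rule G[OF ij(1)])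
  have fin: "finite (pverts (\<Gamma> j))" if "j \<in> {1..l}" for j
    using G[OF that] by (simp add: pair_graph_def pair_digraph_def pair_fin_digraph.pair_finite_verts)
  have N: "{w. ((i, u), w) \<in> parcs (graph_join l \<Gamma>)} =
      Pair i ` {w. (u, w) \<in> parcs (\<Gamma> i)} \<union> (SIGMA j:{1..l} - {i}. pverts (\<Gamma> j))" (is "_ = ?A \<union> ?B")
    using ij uv by (auto simp: graph_join_simps split: if_splits)
  have "finite {w. (u, w) \<in> parcs (\<Gamma> i)}"
    by (rule finite_subset[OF _ Gi.pair_finite_verts]) (auto dest: Gi.in_arcsD2)
  moreover have "finite ?B" using fin by auto
  moreover have "?A \<inter> ?B = {}" by auto
  ultimately have "card (?A \<union> ?B) = card {w. (u, w) \<in> parcs (\<Gamma> i)} + card ?B"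
    by (simp add: card_Un_disjoint card_image inj_on_def)
  moreover have "card ?B = (\<Sum>j\<in>{1..l} - {i}. card (pverts (\<Gamma> j)))"
    using fin by (intro card_SigmaI) auto
  moreover have "K = card (pverts (\<Gamma> i)) + (\<Sum>j\<in>{1..l} - {i}. card (pverts (\<Gamma> j)))"
    unfolding K_def using ij by (intro sum.remove) auto
  ultimately have deg: "int (card {w. ((i, u), w) \<in> parcs (graph_join l \<Gamma>)}) =
      int (card {w. (u, w) \<in> parcs (\<Gamma> i)}) + (int K - int (card (pverts (\<Gamma> i))))"
    by (simp add: N)
  show ?thesis
    unfolding J.laplacian_entry_eq Gi.laplacian_entry_eq
    using ij uv deg by (auto simp: graph_join_simps)
qed

text \<open>Vertices in different parts are joined by an arc, and two vertices of one part are
  handled by connectedness of that part; the case of a single part is thereby included.\<close>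

lemma graph_join_constant:
  assumes G: "\<And>i. i \<in> {1..l} \<Longrightarrow> pair_graph (\<Gamma> i)"
    and conn: "\<And>i. i \<in> {1..l} \<Longrightarrow> Digraph_Component.connected (with_proj (\<Gamma> i))"
    and arcs: "\<And>x y. (x, y) \<in> parcs (graph_join l \<Gamma>) \<Longrightarrow> g x = g y"
    and pq: "p \<in> pverts (graph_join l \<Gamma>)" "q \<in> pverts (graph_join l \<Gamma>)"
  shows "g p = g q"
proof -
  obtain i u j v where p: "p = (i, u)" "q = (j, v)" by (cases p; cases q)
  have ij: "i \<in> {1..l}" "j \<in> {1..l}" "u \<in> pverts (\<Gamma> i)" "v \<in> pverts (\<Gamma> j)"
    using pq by (auto simp: graph_join_simps p)
  show ?thesis
  proof (cases "i = j")
    case True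
    have "g (i, u) = g (i, v)"
      by (rule pair_graph.connected_imp_constant[OF G[OF ij(1)] conn[OF ij(1)], of "\<lambda>x. g (i, x)"])
        (use ij True arcs in \<open>auto simp: graph_join_simps\<close>)
    then show ?thesis using p True by simp
  next
    case False
    then show ?thesis unfolding p using ij by (intro arcs) (simp add: graph_join_simps)
  qed
qed

section \<open>Evaluation of the block determinants\<close>

lemma of_int_det_list_mat: "of_int (det (list_mat xs f)) = det (list_mat xs (\<lambda>x y. of_int (f x y)))"
proof -
  have "map_mat of_int (list_mat xs f) = list_mat xs (\<lambda>x y. of_int (f x y))"
    by (rule eq_matI) auto
  then show ?thesis by (metis of_int_hom.hom_det)
qed

theorem theoremC:
  fixes l :: nat and \<Gamma> :: "nat \<Rightarrow> 'a pair_pre_digraph"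
  assumes "l \<ge> 1"
    and "\<And>i. i \<in> {1..l} \<Longrightarrow> pair_graph (\<Gamma> i)"
    and "\<And>i. i \<in> {1..l} \<Longrightarrow> pverts (\<Gamma> i) \<noteq> {}"
    and "\<And>i. i \<in> {1..l} \<Longrightarrow> Digraph_Component.connected (with_proj (\<Gamma> i))"
  defines "k \<equiv> \<lambda>i. card (pverts (\<Gamma> i))"
  defines "K \<equiv> \<Sum>i=1..l. k i"
  shows "finite (carrier (Pic0 (graph_join l \<Gamma>)))
    \<and> (of_nat (card (carrier (Pic0 (graph_join l \<Gamma>)))) :: rat)
      = of_nat K powi (int l - 2)
        * (\<Prod>i=1..l. \<bar>poly (graph_char_poly (\<Gamma> i)) (of_nat (k i) - of_nat K)\<bar>)"
proof -
  let ?J = "graph_join l \<Gamma>"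
  interpret J: pair_graph ?J by (rule pair_graph_graph_join[OF assms(2)])
  have fin: "finite (pverts (\<Gamma> i))" if "i \<in> {1..l}" for i
    using assms(2)[OF that] by (simp add: pair_graph_def pair_digraph_def pair_fin_digraph.pair_finite_verts)
  then have "\<forall>i\<in>{1..l}. \<exists>xs. set xs = pverts (\<Gamma> i) \<and> distinct xs"
    using finite_distinct_list by blast
  then obtain xs where "\<forall>i\<in>{1..l}. set (xs i) = pverts (\<Gamma> i) \<and> distinct (xs i)"
    using bchoice by metis
  then have xs: "set (xs i) = pverts (\<Gamma> i)" "distinct (xs i)" if "i \<in> {1..l}" for i
    using that by blast+
  have len: "length (xs i) = k i" if "i \<in> {1..l}" for i
    using xs[OF that] distinct_card[of "xs i"] by (simp add: k_def)
  \<comment> \<open>Listing the vertices part by part makes the blocks of \<open>L + J\<close>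
    contiguous.\<close>
  define vs where "vs = concat (map (\<lambda>i. map (Pair i) (xs i)) [1..<Suc l])"
  have set_vs: "set vs = pverts ?J"
    using xs by (auto simp: vs_def graph_join_simps)
  have len_vs: "length vs = K"
  proof -
    have "length vs = (\<Sum>i\<leftarrow>[1..<Suc l]. length (xs i))"
      by (simp add: vs_def length_concat o_def)
    also have "\<dots> = (\<Sum>i=1..l. length (xs i))"
      by (subst sum_list_distinct_conv_sum_set) (auto intro!: sum.cong)
    also have "\<dots> = K" unfolding K_def by (rule sum.cong) (auto simp: len)
    finally show ?thesis .
  qed
  \<comment> \<open>Distinctness follows by counting: the length of \<open>vs\<close> equals the
    number of its elements.\<close>
  have "card (pverts ?J) = K"
    unfolding graph_join_simps K_def k_def using fin by (intro card_SigmaI) auto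
  then have dist_vs: "distinct vs"
    using set_vs len_vs by (intro card_distinct) simp
  have "k 1 > 0"
    using assms(1) assms(3)[of 1] fin[of 1] by (simp add: k_def card_gt_0_iff)
  moreover have "k 1 \<le> K"
    unfolding K_def using assms(1) by (intro member_le_sum) auto
  ultimately have K0: "K > 0" by simp
  have vs_ne: "vs \<noteq> []" using K0 len_vs by auto
  have const: "g p = g q"
    if "\<And>x y. (x, y) \<in> parcs ?J \<Longrightarrow> g x = g y" "p \<in> pverts ?J" "q \<in> pverts ?J"
    for g :: "nat \<times> 'a \<Rightarrow> int" and p q
    by (rule graph_join_constant[of l \<Gamma> g, OF assms(2,4) that])
  note pic = J.card_Pic0_det_plus_one[OF dist_vs set_vs vs_ne const]
  let ?f = "\<lambda>x y. laplacian_entry ?J x y + 1"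
  have "det (list_mat vs ?f) = (\<Prod>i\<in>set [1..<Suc l]. det (list_mat (map (Pair i) (xs i)) ?f))"
    unfolding vs_def
  proof (rule det_list_mat_concat)
    fix i j x y
    assume "i \<in> set [1..<Suc l]" "j \<in> set [1..<Suc l]" "i \<noteq> j"
      "x \<in> set (map (Pair i) (xs i))" "y \<in> set (map (Pair j) (xs j))"
    then show "laplacian_entry ?J x y + 1 = 0"
      using xs laplacian_entry_graph_join[of l \<Gamma> i j, OF assms(2)] by auto
  qed simp
  also have "set [1..<Suc l] = {1..l}" by auto
  finally have "\<bar>of_int (det (list_mat vs ?f))\<bar> =
      (\<Prod>i=1..l. \<bar>of_int (det (list_mat (map (Pair i) (xs i)) ?f)) :: rat\<bar>)"
    by (simp add: abs_prod)
  also have "\<dots> = (\<Prod>i=1..l. of_nat K * \<bar>poly (graph_char_poly (\<Gamma> i)) (of_nat (k i) - of_nat K)\<bar>)"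
  proof (rule prod.cong[OF refl])
    fix i assume i: "i \<in> {1..l}"
    interpret Gi: pair_graph "\<Gamma> i" by (rule assms(2)[OF i])
    \<comment> \<open>With this shift, \<open>det_laplacian_shift\<close> gives the factor
      \<open>?c + k i = K\<close> and evaluates the polynomial at \<open>k i - K\<close>.\<close>
    let ?c = "of_nat K - of_nat (k i) :: rat"
    have ne: "xs i \<noteq> []" using xs(1)[OF i] assms(3)[OF i] by auto
    have "of_int (det (list_mat (map (Pair i) (xs i)) ?f)) =
        det (list_mat (xs i) (\<lambda>u v. of_int (laplacian_entry (\<Gamma> i) u v) + (if u = v then ?c else 0) + 1))"
      unfolding of_int_det_list_mat list_mat_map
    proof (intro arg_cong[of _ _ det] list_mat_cong)
      fix u v assume "u \<in> set (xs i)" "v \<in> set (xs i)"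
      then have "?f (i, u) (i, v) = laplacian_entry (\<Gamma> i) u v + (if u = v then int K - int (k i) else 0) + 1"
        using laplacian_entry_graph_join[of l \<Gamma> i i, OF assms(2) i i] xs(1)[OF i] by (simp add: K_def k_def)
      then show "of_int (?f (i, u) (i, v)) = of_int (laplacian_entry (\<Gamma> i) u v) + (if u = v then ?c else 0) + 1"
        by simp
    qed
    then show "\<bar>of_int (det (list_mat (map (Pair i) (xs i)) ?f))\<bar> =
        of_nat K * \<bar>poly (graph_char_poly (\<Gamma> i)) (of_nat (k i) - of_nat K)\<bar>"
      using Gi.det_laplacian_shift[OF xs(2)[OF i] xs(1)[OF i] ne, of ?c] by (simp add: len[OF i])
  qed
  also have "\<dots> = of_nat K ^ l * (\<Prod>i=1..l. \<bar>poly (graph_char_poly (\<Gamma> i)) (of_nat (k i) - of_nat K)\<bar>)"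
    by (simp add: prod.distrib)
  finally have D: "\<bar>of_int (det (list_mat vs ?f))\<bar> = \<dots>" .
  have "of_int (int (length vs) ^ 2 * int (card (carrier (Pic0 ?J)))) = (of_int \<bar>det (list_mat vs ?f)\<bar> :: rat)"
    using pic(2) by simp
  then have card: "of_nat K ^ 2 * of_nat (card (carrier (Pic0 ?J))) =
      of_nat K ^ l * (\<Prod>i=1..l. \<bar>poly (graph_char_poly (\<Gamma> i)) (of_nat (k i) - of_nat K)\<bar>)"
    using D by (simp add: len_vs)
  \<comment> \<open>The exponent is negative for \<open>l = 1\<close>; since \<open>K\<close> is
    positive, the integer power is a quotient and the squared factor in \<open>card\<close> can be
    divided out.\<close>
  have powi: "(of_nat K :: rat) powi (int l - 2) = of_nat K ^ l / of_nat K ^ 2"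
    using K0 by (simp add: power_int_diff)
  show ?thesis
    unfolding powi using card pic(1) K0 by (simp add: field_simps)
qed

end
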